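(* Let $d\ge5$ and let $F\in\mathbb{R}[x,y]_d$ be a nonzero form. Then the following are equivalent: (a) $\operatorname{ar-rk}(F)=d-1$; (b) $F_\perp$ is a cube of a linear form; (c) the apolar ideal $(F)^\perp$ contains a cube of a (nonzero, real) linear form, but contains no nonzero quadratic forms.
   Context: $\mathbb{R}[x,y]_d$ is the space of binary forms of degree $d$. For $f\in\mathbb{R}[x,y]$ let $\partial(f)$ be the differential operator obtained by replacing $x,y$ by $\partial/\partial x,\partial/\partial y$. For a nonzero form $F\in\mathbb{R}[x,y]_d$, the apolar ideal is the homogeneous ideal $(F)^\perp=\{f\in\mathbb{R}[x,y]:\partial(f)\bullet F=0\}$, with degree-$r$ part $(F)^\perp_r$. It is a complete intersection: $(F)^\perp=(F_\perp,F^\circ)$ for forms $F_\perp,F^\circ\in\mathbb{R}[x,y]$ with $\deg F_\perp\le\deg F^\circ$ and $\deg F_\perp+\deg F^\circ=d+2$; if $\deg F_\perp<\deg F^\circ$ then $F_\perp$ is unique up to nonzero scale. (If the two degrees are equal, $F_\perp$ denotes one of the two generators in any such choice.) A nonzero form $g\in\mathbb{R}[x,y]_r$ has almost real roots if it has at least $r-2$ simple (i.e. multiplicity-one, pairwise non-proportional) linear factors over $\mathbb{R}$; for $r\ge2$ this means $g=q\prod_{i=1}^{r-2}l_i$ over $\mathbb{R}$ with $l_i$ linear, $q$ quadratic, and $l_1,\dots,l_{r-2},q$ pairwise relatively prime. The almost real rank $\operatorname{ar-rk}(F)$ is the minimal $r$ such that there exists a nonzero $g\in(F)^\perp_r$ with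 almost real roots. *)

theory Defs
  imports "HOL-Computational_Algebra.Computational_Algebra"
begin

text \<open>
  The ring of real polynomials in two variables is \<open>real poly poly\<close>, that is, R[x][y]:
  the inner variable is x and the outer variable is y, so \<open>coeff (coeff p j) i\<close> is the
  coefficient of the monomial \<open>x ^ i * y ^ j\<close> in \<open>p\<close>.
\<close>

text \<open>As usual, the zero polynomial is a form of every degree.\<close>

definition binary_form :: "nat \<Rightarrow> real poly poly \<Rightarrow> bool" where
  "binary_form d p \<longleftrightarrow> (\<forall>i j. coeff (coeff p j) i \<noteq> 0 \<longrightarrow> i + j = d)"

definition linear_form :: "real poly poly \<Rightarrow> bool" where
  "linear_form l \<longleftrightarrow> l \<noteq> 0 \<and> binary_form 1 l"

definition partial_x :: "real poly poly \<Rightarrow> real poly poly" where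
  "partial_x = map_poly pderiv"

definition partial_y :: "real poly poly \<Rightarrow> real poly poly" where
  "partial_y = pderiv"

definition apolar_action :: "real poly poly \<Rightarrow> real poly poly \<Rightarrow> real poly poly" where
  "apolar_action f F =
     (\<Sum>j\<le>degree f. \<Sum>i\<le>degree (coeff f j).
        smult [:coeff (coeff f j) i:] ((partial_x ^^ i) ((partial_y ^^ j) F)))"

definition apolar_ideal :: "real poly poly \<Rightarrow> real poly poly set" where
  "apolar_ideal F = {f. apolar_action f F = 0}"

text \<open>
  \<open>apolar_generators d F G H\<close>: for a form \<open>F\<close> of degree \<open>d\<close>, the pair \<open>(G, H)\<close> is an admissible
  choice of the two generators of the apolar ideal of \<open>F\<close>, with \<open>G\<close> the one of smaller
  (or equal) degree.
\<close>

definition apolar_generators ::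
    "nat \<Rightarrow> real poly poly \<Rightarrow> real poly poly \<Rightarrow> real poly poly \<Rightarrow> bool" where
  "apolar_generators d F G H \<longleftrightarrow>
     G \<noteq> 0 \<and> H \<noteq> 0 \<and>
     (\<exists>a b. binary_form a G \<and> binary_form b H \<and> a \<le> b \<and> a + b = d + 2) \<and>
     apolar_ideal F = {u * G + v * H | u v. True}"

text \<open>
  The truncated subtraction \<open>r - 2\<close> is harmless: for \<open>r < 2\<close> the condition of having at least
  \<open>r - 2\<close> simple real linear factors is void.
\<close>

definition almost_real_roots :: "nat \<Rightarrow> real poly poly \<Rightarrow> bool" where
  "almost_real_roots r g \<longleftrightarrow>
     g \<noteq> 0 \<and> binary_form r g \<and>
     (\<exists>L. finite L \<and> card L \<ge> r - 2 \<and>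
          (\<forall>l\<in>L. linear_form l \<and> l dvd g \<and> \<not> l ^ 2 dvd g) \<and>
          pairwise (\<lambda>l m. \<forall>c. m \<noteq> smult [:c:] l) L)"

text \<open>
  For nonzero \<open>F\<close> of degree \<open>d\<close> the minimum exists, since every form of degree \<open>d + 1\<close> is apolar
  to \<open>F\<close>.
\<close>

definition ar_rk :: "real poly poly \<Rightarrow> nat" where
  "ar_rk F = (LEAST r. \<exists>g\<in>apolar_ideal F. almost_real_roots r g)"

end

theory Submission
  imports Defs
begin

text \<open>
  Suppose that the apolar ideal of F contains no nonzero form of degree k - 1, with k = 3 or
  k = 4, and that d \<open>\<ge>\<close> 2k - 2. Then there is an apolar form of degree d + 2 - k with almost real
  roots. If d = 2k - 2, the ideal has two generators of degree k, and the member of their pencil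
  through a general real point has only simple real linear factors, because multiple factors can
  occur only at the finitely many zeros of the Wronskian. If d > 2k - 2, a general linear form l
  does not divide the generator of smaller degree, so \<open>\<partial>(l) \<bullet> F\<close> satisfies the same hypothesis in degree
  d - 1, and a form apolar to it becomes apolar to F after multiplication by l.

  With k = 3 this gives the upper bound d - 1 for the almost real rank when the smaller generator is
  a cube; all apolar forms of degree less than d - 1 are then multiples of the cube and have too few
  simple factors. If the smaller generator is not a cube, its degree a decides: for a \<open>\<le>\<close> 2 it
  has almost real roots trivially, for a = 3 it has a simple real factor, and for a \<open>\<ge>\<close> 4 the case
  k = 4 applies.

  The two generators themselves are found by induction on d: if G and H generate the apolar ideal
  of the y-derivative of F, then G and H send F to multiples of powers of x, and after subtracting
  a multiple of one generator from the other one of them kills F; the other one is multiplied by y.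
\<close>

section \<open>The apolar action\<close>

lemma coeff_partial_x [simp]: "coeff (partial_x F) j = pderiv (coeff F j)"
  by (simp add: partial_x_def coeff_map_poly)

lemma coeff_partial_y [simp]: "coeff (partial_y F) j = of_nat (Suc j) * coeff F (Suc j)"
  by (simp add: partial_y_def coeff_pderiv)

lemma partial_x_0 [simp]: "partial_x 0 = 0" and partial_y_0 [simp]: "partial_y 0 = 0"
  by (simp_all add: partial_x_def partial_y_def)

lemma partial_x_add: "partial_x (F + G) = partial_x F + partial_x G"
  by (rule poly_eqI) (simp add: pderiv_add)

lemma partial_y_add: "partial_y (F + G) = partial_y F + partial_y G"
  by (simp add: partial_y_def pderiv_add)

lemma partial_x_smult: "partial_x (smult [:c:] F) = smult [:c:] (partial_x F)"
  by (rule poly_eqI) (simp add: pderiv_smult)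

lemma partial_y_smult: "partial_y (smult c F) = smult c (partial_y F)"
  by (simp add: partial_y_def pderiv_smult)

lemma partial_x_partial_y: "partial_x (partial_y F) = partial_y (partial_x F)"
proof -
  have "pderiv (of_nat n * p) = of_nat n * pderiv p" for n and p :: "real poly"
    by (simp add: of_nat_poly pderiv_smult)
  then show ?thesis
    by (intro poly_eqI) (simp del: of_nat_Suc)
qed

text \<open>Action of a polynomial in x alone. It turns the double sum of
  \<open>apolar_action\<close> into two nested recursions along \<open>pCons\<close>, so that
  linearity and multiplicativity follow by plain induction on the operator.\<close>

definition x_action :: "real poly \<Rightarrow> real poly poly \<Rightarrow> real poly poly" where
  "x_action c F = (\<Sum>i\<le>degree c. smult [:coeff c i:] ((partial_x ^^ i) F))"

lemma x_action_0_left [simp]: "x_action 0 F = 0"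
  by (simp add: x_action_def)

lemma x_action_pCons: "x_action (pCons a c) F = smult [:a:] F + x_action c (partial_x F)"
proof (cases "c = 0")
  case False
  then show ?thesis
    unfolding x_action_def degree_pCons_eq[OF False]
    by (subst sum.atMost_Suc_shift) (simp add: funpow_Suc_right del: funpow.simps(2))
qed (simp add: x_action_def)

lemma apolar_action_conv_x_action:
  "apolar_action f F = (\<Sum>j\<le>degree f. x_action (coeff f j) ((partial_y ^^ j) F))"
  by (simp add: apolar_action_def x_action_def)

lemma apolar_action_0_left [simp]: "apolar_action 0 F = 0"
  by (simp add: apolar_action_conv_x_action)

lemma apolar_action_pCons:
  "apolar_action (pCons c f) F = x_action c F + apolar_action f (partial_y F)"
proof (cases "f = 0")
  case False
  then show ?thesis
    unfolding apolar_action_conv_x_action degree_pCons_eq[OF False]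
    by (subst sum.atMost_Suc_shift) (simp add: funpow_Suc_right del: funpow.simps(2))
qed (simp add: apolar_action_conv_x_action)

lemma x_action_add_right: "x_action c (F + G) = x_action c F + x_action c G"
  by (induction c arbitrary: F G) (simp_all add: x_action_pCons partial_x_add smult_add_right)

lemma x_action_smult_right: "x_action c (smult [:k:] F) = smult [:k:] (x_action c F)"
  by (induction c arbitrary: F)
     (simp_all add: x_action_pCons partial_x_smult smult_add_right mult.commute)

lemma x_action_0_right [simp]: "x_action c 0 = 0"
  using x_action_smult_right[of c 0 0] by simp

lemma x_action_partial_x: "x_action c (partial_x F) = partial_x (x_action c F)"
  by (induction c arbitrary: F) (simp_all add: x_action_pCons partial_x_add partial_x_smult)

lemma x_action_partial_y: "x_action c (partial_y F) = partial_y (x_action c F)"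
  by (induction c arbitrary: F)
     (simp_all add: x_action_pCons partial_y_add partial_y_smult partial_x_partial_y)

lemma x_action_add_left: "x_action (b + c) F = x_action b F + x_action c F"
proof (induction b c arbitrary: F rule: poly_induct2)
  case (pCons a p b q)
  have "smult [:a + b:] F = smult [:a:] F + smult [:b:] F"
    by (metis add_pCons add.right_neutral smult_add_left)
  with pCons show ?case by (simp add: x_action_pCons)
qed simp

lemma x_action_smult_left: "x_action (smult k c) F = smult [:k:] (x_action c F)"
  by (induction c arbitrary: F) (simp_all add: x_action_pCons smult_add_right mult.commute)

lemma x_action_mult: "x_action (b * c) F = x_action b (x_action c F)"
  by (induction b arbitrary: F)
     (simp_all add: x_action_pCons x_action_add_left x_action_smult_left x_action_partial_x)

lemma apolar_action_smult_right:
  "apolar_action f (smult [:k:] F) = smult [:k:] (apolar_action f F)"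
  by (induction f arbitrary: F)
     (simp_all add: apolar_action_pCons x_action_smult_right partial_y_smult smult_add_right)

lemma apolar_action_0_right [simp]: "apolar_action f 0 = 0"
  using apolar_action_smult_right[of f 0 0] by simp

lemma apolar_action_partial_y: "apolar_action f (partial_y F) = partial_y (apolar_action f F)"
  by (induction f arbitrary: F)
     (simp_all add: apolar_action_pCons partial_y_add x_action_partial_y)

lemma apolar_action_add: "apolar_action (f + g) F = apolar_action f F + apolar_action g F"
  by (induction f g arbitrary: F rule: poly_induct2)
     (simp_all add: apolar_action_pCons x_action_add_left)

lemma apolar_action_smult: "apolar_action (smult c f) F = x_action c (apolar_action f F)"
  by (induction f arbitrary: F)
     (simp_all add: apolar_action_pCons x_action_mult x_action_add_right)

lemma apolar_action_mult: "apolar_action (f * g) F = apolar_action f (apolar_action g F)"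
  by (induction f arbitrary: F)
     (simp_all add: apolar_action_pCons apolar_action_add apolar_action_smult
        apolar_action_partial_y)

lemma smult_const_1 [simp]: "smult [:1:] (F :: real poly poly) = F"
  by (simp flip: one_pCons)

lemma x_action_const [simp]: "x_action [:k:] F = smult [:k:] F"
  using x_action_pCons[of k 0 F] by simp

lemma x_action_1 [simp]: "x_action 1 F = F"
  by (simp add: one_pCons)

lemma apolar_action_sum: "apolar_action (sum f A) F = (\<Sum>a\<in>A. apolar_action (f a) F)"
  by (induction A rule: infinite_finite_induct) (simp_all add: apolar_action_add)

abbreviation (input) X :: "real poly poly" where "X \<equiv> [:[:0, 1:]:]"
abbreviation (input) Y :: "real poly poly" where "Y \<equiv> [:0, 1:]"

lemma apolar_action_X: "apolar_action X F = partial_x F"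
  by (simp add: apolar_action_pCons x_action_pCons)

lemma apolar_action_1 [simp]: "apolar_action 1 F = F"
  by (simp add: one_pCons apolar_action_pCons x_action_pCons)

lemma apolar_action_Y: "apolar_action Y F = partial_y F"
  by (simp add: apolar_action_pCons x_action_pCons)

section \<open>Ideal properties of the apolar ideal\<close>

lemma apolar_ideal_iff: "f \<in> apolar_ideal F \<longleftrightarrow> apolar_action f F = 0"
  by (simp add: apolar_ideal_def)

lemma apolar_ideal_add: "f \<in> apolar_ideal F \<Longrightarrow> g \<in> apolar_ideal F \<Longrightarrow> f + g \<in> apolar_ideal F"
  by (simp add: apolar_ideal_iff apolar_action_add)

lemma apolar_ideal_mult: "f \<in> apolar_ideal F \<Longrightarrow> u * f \<in> apolar_ideal F"
  by (simp add: apolar_ideal_iff apolar_action_mult)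

text \<open>The link between degrees in the inductions: a form apolar to a derivative of F becomes
  apolar to F after multiplication by the differentiating form, and conversely.\<close>

lemma mult_in_apolar_ideal_iff: "f * g \<in> apolar_ideal F \<longleftrightarrow> f \<in> apolar_ideal (apolar_action g F)"
  by (simp add: apolar_ideal_iff apolar_action_mult)

section \<open>Binary forms\<close>

lemma binary_formD: "binary_form r f \<Longrightarrow> i + j \<noteq> r \<Longrightarrow> coeff (coeff f j) i = 0"
  by (auto simp: binary_form_def)

lemma binary_form_0 [simp]: "binary_form r 0"
  by (simp add: binary_form_def)

lemma binary_form_add: "binary_form r f \<Longrightarrow> binary_form r g \<Longrightarrow> binary_form r (f + g)"
  unfolding binary_form_def by (metis add.right_neutral coeff_add)

lemma binary_form_smult: "binary_form r f \<Longrightarrow> binary_form r (smult [:c:] f)"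
  by (auto simp: binary_form_def)

lemma binary_form_diff: "binary_form r f \<Longrightarrow> binary_form r g \<Longrightarrow> binary_form r (f - g)"
  unfolding binary_form_def by (metis diff_zero coeff_diff)

lemma binary_form_mult:
  assumes "binary_form r f" "binary_form s g"
  shows "binary_form (r + s) (f * g)"
  unfolding binary_form_def
proof (intro allI impI)
  fix i j
  assume "coeff (coeff (f * g) j) i \<noteq> 0"
  then have "(\<Sum>k\<le>j. \<Sum>h\<le>i. coeff (coeff f k) h * coeff (coeff g (j - k)) (i - h)) \<noteq> 0"
    by (simp add: coeff_mult coeff_sum)
  then obtain k h where "k \<le> j" "h \<le> i" "coeff (coeff f k) h \<noteq> 0" "coeff (coeff g (j - k)) (i - h) \<noteq> 0"
    by (metis (no_types, lifting) atMost_iff mult_eq_0_iff sum.not_neutral_contains_not_neutral)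
  with assms have "h + k = r" "i - h + (j - k) = s"
    by (auto simp: binary_form_def)
  with \<open>k \<le> j\<close> \<open>h \<le> i\<close> show "i + j = r + s"
    by linarith
qed

lemma binary_form_1 [simp]: "binary_form 0 1"
  by (auto simp: binary_form_def coeff_1 split: if_splits)

lemma binary_form_X [simp]: "binary_form 1 X"
  by (auto simp: binary_form_def coeff_pCons split: nat.splits)

lemma binary_form_Y [simp]: "binary_form 1 Y"
  by (auto simp: binary_form_def coeff_pCons split: nat.splits)

lemma binary_form_power:
  assumes "binary_form r f"
  shows "binary_form (n * r) (f ^ n)"
  by (induction n) (auto intro: binary_form_mult[OF assms])

lemma binary_form_X_power [simp]: "binary_form n (X ^ n)"
  using binary_form_power[OF binary_form_X, of n] by simp

lemma X_power: "X ^ n = [:monom 1 n:]"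
  by (induction n) (simp_all add: monom_Suc one_pCons flip: monom_Suc)

lemma binary_form_unique_degree:
  assumes "binary_form r f" "binary_form s f" "f \<noteq> 0"
  shows "r = s"
proof -
  from \<open>f \<noteq> 0\<close> obtain i j where "coeff (coeff f j) i \<noteq> 0"
    by (metis coeff_0 poly_eqI)
  with assms show ?thesis by (auto simp: binary_form_def)
qed

section \<open>Homogeneous components\<close>

definition hom_part :: "nat \<Rightarrow> real poly poly \<Rightarrow> real poly poly" where
  "hom_part r f = (\<Sum>j\<le>r. monom (monom (coeff (coeff f j) (r - j)) (r - j)) j)"

lemma coeff_hom_part:
  "coeff (coeff (hom_part r f) j) i = (if i + j = r then coeff (coeff f j) i else 0)"
proof -
  have "coeff (coeff (hom_part r f) j) i =
      (\<Sum>k\<le>r. if k = j then coeff (monom (coeff (coeff f k) (r - k)) (r - k)) i else 0)"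
    unfolding hom_part_def coeff_sum by (intro sum.cong) auto
  also have "\<dots> = (if i + j = r then coeff (coeff f j) i else 0)"
    by auto
  finally show ?thesis .
qed

lemma binary_form_hom_part [simp]: "binary_form r (hom_part r f)"
  by (auto simp: binary_form_def coeff_hom_part split: if_splits)

lemma hom_part_binary_form:
  "binary_form s f \<Longrightarrow> hom_part r f = (if r = s then f else 0)"
  by (auto intro!: poly_eqI simp: coeff_hom_part binary_formD)

lemma hom_part_0 [simp]: "hom_part r 0 = 0"
  by (simp add: hom_part_def)

lemma hom_part_add: "hom_part r (f + g) = hom_part r f + hom_part r g"
  by (auto intro!: poly_eqI simp: coeff_hom_part)

lemma hom_part_sum: "hom_part r (sum f A) = (\<Sum>a\<in>A. hom_part r (f a))"
  by (induction A rule: infinite_finite_induct) (simp_all add: hom_part_add)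

text \<open>The upper limit is left free above N because later sums run to \<open>N + r\<close>, so
  that the component of degree r certainly occurs in them.\<close>

lemma sum_hom_part: "\<exists>N. \<forall>n\<ge>N. f = (\<Sum>r\<le>n. hom_part r f)"
proof (induction f)
  case (pCons c f)
  then obtain N where N: "\<And>n. n \<ge> N \<Longrightarrow> f = (\<Sum>r\<le>n. hom_part r f)"
    by blast
  have "pCons c f = (\<Sum>r\<le>n. hom_part r (pCons c f))" if n: "n \<ge> N + Suc (degree c)" for n
  proof (intro poly_eqI)
    fix i j
    have "i + j \<le> n" if "coeff (coeff (pCons c f) j) i \<noteq> 0"
    proof (cases j)
      case 0
      with that have "i \<le> degree c"
        by (simp add: le_degree)
      with 0 n show ?thesis by simp
    next
      case (Suc k)
      with that have nz: "coeff (coeff f k) i \<noteq> 0" by simp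
      have "f = (\<Sum>r\<le>n - 1. hom_part r f)"
        using n by (intro N) simp
      then have "coeff (coeff f k) i = coeff (coeff (\<Sum>r\<le>n - 1. hom_part r f) k) i"
        by simp
      then have "i + k \<le> n - 1"
        using nz by (auto simp: coeff_sum coeff_hom_part split: if_splits)
      with Suc n show ?thesis by simp
    qed
    then show "coeff (coeff (pCons c f) j) i = coeff (coeff (\<Sum>r\<le>n. hom_part r (pCons c f)) j) i"
      by (auto simp: coeff_sum coeff_hom_part)
  qed
  then show ?case by blast
qed simp

lemma hom_part_mult:
  assumes "binary_form s g"
  shows "hom_part r (f * g) = (if s \<le> r then hom_part (r - s) f * g else 0)"
proof -
  obtain N where "\<forall>n\<ge>N. f = (\<Sum>k\<le>n. hom_part k f)"
    using sum_hom_part by blast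
  then have f: "f = (\<Sum>k\<le>N + r. hom_part k f)"
    by simp
  then have "f * g = (\<Sum>k\<le>N + r. hom_part k f) * g"
    by simp
  then have "hom_part r (f * g) = (\<Sum>k\<le>N + r. hom_part r (hom_part k f * g))"
    by (simp add: hom_part_sum sum_distrib_right)
  also have "\<dots> = (\<Sum>k\<le>N + r. if r = k + s then hom_part k f * g else 0)"
    by (intro sum.cong refl hom_part_binary_form binary_form_mult binary_form_hom_part assms)
  also have "\<dots> = (\<Sum>k\<le>N + r. if k = r - s then (if s \<le> r then hom_part k f * g else 0) else 0)"
    by (intro sum.cong) auto
  also have "\<dots> = (if s \<le> r then hom_part (r - s) f * g else 0)"
    by auto
  finally show ?thesis .
qed

text \<open>The part of degree r of the product is the part of f of degree \<open>r - s\<close>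
  times g. Cancelling g identifies f with one of its own components.\<close>

lemma binary_form_cofactor:
  assumes "binary_form s g" "g \<noteq> 0" "binary_form r (f * g)" "f \<noteq> 0"
  obtains "s \<le> r" "binary_form (r - s) f"
proof -
  have "f * g = hom_part r (f * g)"
    using assms by (simp add: hom_part_binary_form)
  also have "\<dots> = (if s \<le> r then hom_part (r - s) f * g else 0)"
    by (rule hom_part_mult[OF assms(1)])
  finally have "s \<le> r" and "f * g = hom_part (r - s) f * g"
    using assms by (auto split: if_splits)
  then have "s \<le> r" "f = hom_part (r - s) f"
    using assms by auto
  then show ?thesis
    using that by (metis binary_form_hom_part)
qed

text \<open>Separates the pure power of x from a multiple of y; all inductions on the degree of a
  form rest on this. The last clause makes up for the truncated \<open>r - 1\<close> at r =
  0.\<close>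

lemma binary_form_decomp:
  assumes "binary_form r f"
  obtains f1 \<gamma> where "f = Y * f1 + smult [:\<gamma>:] (X ^ r)" "binary_form (r - 1) f1" "r = 0 \<longrightarrow> f1 = 0"
proof -
  obtain c f1 where f: "f = pCons c f1"
    by (meson pCons_cases)
  have "coeff c i = 0" if "i \<noteq> r" for i
    using binary_formD[OF assms, of i 0] that by (simp add: f)
  then have c: "c = monom (coeff c r) r"
    by (intro poly_eqI) auto
  have f1: "i + Suc j = r" if "coeff (coeff f1 j) i \<noteq> 0" for i j
    using binary_formD[OF assms, of i "Suc j"] that by (auto simp: f)
  then have "binary_form (r - 1) f1"
    by (fastforce simp: binary_form_def)
  moreover have "r = 0 \<longrightarrow> f1 = 0"
    using f1 by (metis Zero_not_Suc add_Suc_right coeff_0 poly_eqI)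
  moreover have "f = Y * f1 + smult [:coeff c r:] (X ^ r)"
    using c by (simp add: f X_power smult_monom)
  ultimately show ?thesis using that by blast
qed

section \<open>Derivatives of forms and homogeneity of the apolar ideal\<close>

lemma binary_form_partial_x: "binary_form d F \<Longrightarrow> binary_form (d - 1) (partial_x F)"
  by (fastforce simp: binary_form_def coeff_pderiv)

lemma of_nat_mult_poly: "coeff (of_nat n * p) i = of_nat n * coeff p i"
  by (simp add: of_nat_poly)

lemma binary_form_partial_y: "binary_form d F \<Longrightarrow> binary_form (d - 1) (partial_y F)"
  by (fastforce simp: binary_form_def of_nat_mult_poly simp del: of_nat_Suc)

lemma partial_x_binary_form_0: "binary_form 0 F \<Longrightarrow> partial_x F = 0"
  by (intro poly_eqI) (simp add: binary_formD coeff_pderiv)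

lemma partial_y_binary_form_0: "binary_form 0 F \<Longrightarrow> partial_y F = 0"
  by (intro poly_eqI) (simp add: binary_formD of_nat_mult_poly del: of_nat_Suc)

text \<open>A form of positive degree is f1 * y + f2 * x, which reduces the claim to the two first
  derivatives of F. The second conjunct keeps the information that the truncated
  \<open>d - r\<close> loses.\<close>

lemma apolar_action_form:
  assumes "binary_form r f" "binary_form d F"
  shows "binary_form (d - r) (apolar_action f F) \<and> (d < r \<longrightarrow> apolar_action f F = 0)"
  using assms
proof (induction r arbitrary: d f F)
  case 0
  obtain f1 \<gamma> where "f = Y * f1 + smult [:\<gamma>:] (X ^ 0)" "f1 = 0"
    using binary_form_decomp[OF 0(1)] by blast
  then have "apolar_action f F = smult [:\<gamma>:] F"
    by (simp add: apolar_action_pCons)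
  with 0 show ?case by (simp add: binary_form_smult)
next
  case (Suc r)
  obtain f1 \<gamma> where f: "f = Y * f1 + smult [:\<gamma>:] (X ^ Suc r)" "binary_form r f1"
    using binary_form_decomp[OF Suc(2)] by auto
  define f2 where "f2 = smult [:\<gamma>:] (X ^ r)"
  have f2: "binary_form r f2"
    by (simp add: f2_def binary_form_smult)
  have "f = f1 * Y + f2 * X"
    using f(1) by (simp add: f2_def mult.commute)
  then have act: "apolar_action f F = apolar_action f1 (partial_y F) + apolar_action f2 (partial_x F)"
    by (simp only: apolar_action_add apolar_action_mult apolar_action_X apolar_action_Y)
  show ?case
  proof (cases d)
    case 0
    then show ?thesis
      using Suc.prems by (simp add: act partial_x_binary_form_0 partial_y_binary_form_0)
  next
    case (Suc e)
    then have "binary_form e (partial_x F)" "binary_form e (partial_y F)"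
      using binary_form_partial_x binary_form_partial_y \<open>binary_form d F\<close> by fastforce+
    with Suc.IH f(2) f2 show ?thesis
      unfolding act by (auto simp: Suc intro!: binary_form_add)
  qed
qed

text \<open>Components of different degrees k up to d send F to forms of different degrees d - k, so
  their contributions cannot cancel. Components of degree above d kill F anyway.\<close>

lemma hom_part_in_apolar_ideal:
  assumes "binary_form d F" "f \<in> apolar_ideal F"
  shows "hom_part r f \<in> apolar_ideal F"
proof (cases "r \<le> d")
  case True
  obtain N where "\<forall>n\<ge>N. f = (\<Sum>k\<le>n. hom_part k f)"
    using sum_hom_part by blast
  then have "f = (\<Sum>k\<le>N + r. hom_part k f)"
    by simp
  then have "0 = apolar_action (\<Sum>k\<le>N + r. hom_part k f) F"
    using assms(2) by (simp add: apolar_ideal_iff)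
  then have "0 = hom_part (d - r) (apolar_action (\<Sum>k\<le>N + r. hom_part k f) F)"
    by simp
  also have "\<dots> = (\<Sum>k\<le>N + r. hom_part (d - r) (apolar_action (hom_part k f) F))"
    by (simp add: apolar_action_sum hom_part_sum)
  also have "\<dots> = (\<Sum>k\<le>N + r. if k = r then apolar_action (hom_part k f) F else 0)"
  proof (intro sum.cong refl)
    fix k
    have "binary_form (d - k) (apolar_action (hom_part k f) F)"
         "d < k \<longrightarrow> apolar_action (hom_part k f) F = 0"
      using apolar_action_form[OF binary_form_hom_part assms(1)] by blast+
    with True show "hom_part (d - r) (apolar_action (hom_part k f) F) =
        (if k = r then apolar_action (hom_part k f) F else 0)"
      by (cases "d < k") (auto simp: hom_part_binary_form)
  qed
  also have "\<dots> = apolar_action (hom_part r f) F"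
    by simp
  finally show ?thesis by (simp add: apolar_ideal_iff)
next
  case False
  then show ?thesis
    using apolar_action_form[OF binary_form_hom_part assms(1)] by (simp add: apolar_ideal_iff)
qed

text \<open>By homogeneity it is enough to express the apolar forms through G and H; the expressions
  for the components of an arbitrary element are then added up.\<close>

lemma apolar_ideal_eqI:
  assumes "binary_form d F" "G \<in> apolar_ideal F" "H \<in> apolar_ideal F"
    and "\<And>r f. binary_form r f \<Longrightarrow> f \<in> apolar_ideal F \<Longrightarrow> \<exists>u v. f = u * G + v * H"
  shows "apolar_ideal F = {u * G + v * H | u v. True}"
proof (intro equalityI subsetI)
  fix f
  assume "f \<in> apolar_ideal F"
  then have "\<exists>u v. hom_part r f = u * G + v * H" for r
    using assms(1,4) hom_part_in_apolar_ideal binary_form_hom_part by blast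
  then obtain u v where uv: "\<And>r. hom_part r f = u r * G + v r * H"
    by metis
  obtain N where "f = (\<Sum>k\<le>N. hom_part k f)"
    using sum_hom_part by blast
  also have "\<dots> = (\<Sum>k\<le>N. u k) * G + (\<Sum>k\<le>N. v k) * H"
    by (simp add: uv sum.distrib sum_distrib_right)
  finally show "f \<in> {u * G + v * H | u v. True}"
    by blast
qed (use assms in \<open>auto intro: apolar_ideal_add apolar_ideal_mult\<close>)

section \<open>Generators of the apolar ideal\<close>

text \<open>Nondegeneracy of the apolar pairing in degree d. Multiplying test forms by x and y
  passes the hypothesis on to both first derivatives, which vanish by induction.\<close>

lemma apolar_ideal_eq_0I:
  assumes "binary_form d F" "\<And>f. binary_form d f \<Longrightarrow> f \<in> apolar_ideal F"
  shows "F = 0"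
  using assms
proof (induction d arbitrary: F)
  case 0
  then have "1 \<in> apolar_ideal F" by simp
  then show ?case by (simp add: apolar_ideal_iff)
next
  case (Suc d)
  have "f \<in> apolar_ideal (partial_x F)" "f \<in> apolar_ideal (partial_y F)"
    if f: "binary_form d f" for f
  proof -
    have "f * X \<in> apolar_ideal F" "f * Y \<in> apolar_ideal F"
      using Suc.prems(2)[of "f * X"] Suc.prems(2)[of "f * Y"]
        binary_form_mult[OF f binary_form_X] binary_form_mult[OF f binary_form_Y] by simp_all
    then show "f \<in> apolar_ideal (partial_x F)" "f \<in> apolar_ideal (partial_y F)"
      unfolding mult_in_apolar_ideal_iff apolar_action_X apolar_action_Y .
  qed
  then have 0: "partial_x F = 0" "partial_y F = 0"
    using Suc.IH binary_form_partial_x[OF Suc.prems(1)] binary_form_partial_y[OF Suc.prems(1)]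
    by simp_all
  have "coeff F (Suc j) = 0" for j
    using arg_cong[OF 0(2), of "\<lambda>p. coeff p j"] by (simp add: of_nat_poly del: of_nat_Suc)
  moreover have "coeff (coeff F 0) (Suc i) = 0" for i
    using arg_cong[OF 0(1), of "\<lambda>p. coeff (coeff p 0) i"] by (simp add: coeff_pderiv del: of_nat_Suc)
  moreover have "coeff (coeff F 0) 0 = 0"
    using binary_formD[OF Suc.prems(1), of 0 0] by simp
  ultimately have "coeff (coeff F j) i = 0" for i j
    by (cases j; cases i) simp_all
  then show ?case
    by (metis coeff_0 poly_eqI)
qed

lemma partial_y_eq_0:
  assumes "binary_form d F" "partial_y F = 0"
  obtains c where "F = smult [:c:] (X ^ d)"
proof -
  obtain F1 c where F: "F = Y * F1 + smult [:c:] (X ^ d)"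
    using binary_form_decomp[OF assms(1)] by metis
  have "coeff F (Suc j) = 0" for j
    using arg_cong[OF assms(2), of "\<lambda>p. coeff p j"] by (simp add: of_nat_poly del: of_nat_Suc)
  then have "coeff F1 j = 0" for j
    unfolding F X_power by simp
  then have "F1 = 0"
    by (simp add: poly_eq_iff)
  with F that show ?thesis by simp
qed

text \<open>The constant is d! / (d - k)!; only its being nonzero matters later.\<close>

lemma apolar_action_X_power:
  "k \<le> d \<Longrightarrow> \<exists>c. c \<noteq> 0 \<and> apolar_action (X ^ k) (X ^ d) = smult [:c:] (X ^ (d - k))"
proof (induction k arbitrary: d)
  case (Suc k)
  then obtain e where d: "d = Suc e" "k \<le> e"
    by (metis Suc_le_D Suc_le_mono)
  have "partial_x (X ^ Suc e) = smult [:of_nat (Suc e):] (X ^ e)"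
    unfolding X_power
    by (intro poly_eqI) (simp add: coeff_pCons pderiv_monom smult_monom split: nat.splits)
  moreover from Suc.IH[OF d(2)] obtain c
    where "c \<noteq> 0" "apolar_action (X ^ k) (X ^ e) = smult [:c:] (X ^ (e - k))"
    by blast
  ultimately have "apolar_action (X ^ Suc k) (X ^ d) = smult [:of_nat (Suc e) * c:] (X ^ (d - Suc k))"
    unfolding power_Suc2 apolar_action_mult apolar_action_X d(1)
    by (simp add: apolar_action_smult_right mult.commute del: of_nat_Suc power_Suc)
  with \<open>c \<noteq> 0\<close> show ?case
    by (intro exI[of _ "of_nat (Suc e) * c"]) simp
qed (auto intro: exI[of _ 1])

lemma apolar_action_Y_mult_X_power: "apolar_action (Y * u) (X ^ d) = 0"
proof -
  have "partial_y (X ^ d) = 0"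
    by (simp add: X_power partial_y_def pderiv_pCons)
  then have "apolar_action (u * Y) (X ^ d) = 0"
    unfolding apolar_action_mult apolar_action_Y by simp
  then show ?thesis by (simp add: mult.commute)
qed

lemma smult_cancel:
  fixes f g :: "real poly poly"
  assumes "smult [:c:] f = g" "c \<noteq> 0"
  shows "f = smult [:1 / c:] g"
  unfolding assms(1)[symmetric] using assms(2) by simp

text \<open>Unlike \<open>apolar_generators\<close>, this exposes the degrees and imposes no
  condition on them. It is thus symmetric in the two generators, and either can take either role in
  the induction.\<close>

definition generates :: "real poly poly \<Rightarrow> nat \<Rightarrow> real poly poly \<Rightarrow> nat \<Rightarrow> real poly poly \<Rightarrow> bool" where
  "generates F a G b H \<longleftrightarrow> binary_form a G \<and> binary_form b H \<and> G \<noteq> 0 \<and> H \<noteq> 0 \<and>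
     apolar_ideal F = {u * G + v * H | u v. True}"

lemma generates_commute: "generates F a G b H \<Longrightarrow> generates F b H a G"
  unfolding generates_def by (auto; metis add.commute)

text \<open>Taking the part of degree r on both sides replaces arbitrary cofactors by homogeneous
  ones; a cofactor that would need negative degree disappears.\<close>

lemma form_combination:
  assumes "binary_form r f" "binary_form a G" "binary_form b H" "f = u * G + v * H"
  obtains u' v' where "f = u' * G + v' * H"
    "binary_form (r - a) u'" "r < a \<longrightarrow> u' = 0" "binary_form (r - b) v'" "r < b \<longrightarrow> v' = 0"
proof -
  define u' where "u' = (if a \<le> r then hom_part (r - a) u else 0)"
  define v' where "v' = (if b \<le> r then hom_part (r - b) v else 0)"
  have "f = hom_part r (u * G + v * H)"
    using assms by (metis hom_part_binary_form)
  also have "\<dots> = u' * G + v' * H"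
    by (simp add: hom_part_add hom_part_mult[OF assms(2)] hom_part_mult[OF assms(3)] u'_def v'_def)
  finally show ?thesis
    using that by (auto simp: u'_def v'_def)
qed

lemma generatesD:
  assumes "generates F a G b H" "binary_form r f" "f \<in> apolar_ideal F"
  obtains u v where "f = u * G + v * H"
    "binary_form (r - a) u" "r < a \<longrightarrow> u = 0" "binary_form (r - b) v" "r < b \<longrightarrow> v = 0"
  using assms form_combination[OF assms(2)] unfolding generates_def by blast

lemma generates_mem:
  assumes "generates F a G b H"
  shows "G \<in> apolar_ideal F" "H \<in> apolar_ideal F"
proof -
  have "\<exists>u v. G = u * G + v * H" "\<exists>u v. H = u * G + v * H"
    by (rule exI[of _ 1], rule exI[of _ 0], simp, rule exI[of _ 0], rule exI[of _ 1], simp)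
  with assms show "G \<in> apolar_ideal F" "H \<in> apolar_ideal F"
    unfolding generates_def by auto
qed

text \<open>A divisor of a power of x has degree 0 in y. Dividing a power of y as well, its
  remaining coefficient divides 1 and is a constant.\<close>

lemma common_divisor_of_powers:
  assumes "binary_form a G" "u * G = X ^ m" "v * G = Y ^ m"
  shows "a = 0"
proof -
  have "degree (u * G) = 0"
    by (simp add: assms(2) X_power)
  moreover have "u \<noteq> 0" "G \<noteq> 0"
    using assms(2) by (auto simp: X_power)
  ultimately have "degree G = 0"
    by (simp add: degree_mult_eq)
  then obtain c where G: "G = [:c:]"
    by (metis degree_eq_zeroE)
  have "Y ^ m = monom 1 m"
    by (metis monom_altdef smult_1_left)
  then have "coeff (v * G) m = 1"
    by (simp add: assms(3))
  then have "coeff v m * c = 1"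
    by (simp add: G mult.commute)
  then have "degree c = 0" "c \<noteq> 0"
    by (metis is_unit_polyE degree_pCons_0 dvd_triv_right, auto)
  then have "coeff (coeff G 0) 0 \<noteq> 0"
    by (auto simp: G elim: degree_eq_zeroE)
  with assms(1) show ?thesis
    by (auto simp: binary_form_def)
qed

text \<open>If f = u * P + v * Q kills F, then so does u * P, hence u kills a power of x. In degrees
  up to d this forces y to divide u. In higher degrees the pure power of x in u is rewritten modulo
  Q, which is possible because y does not divide Q.\<close>

lemma generates_partial_y:
  assumes F: "binary_form d F" and gen: "generates (partial_y F) p P q Q"
    and "p \<le> d" "p + q = d + 1"
    and P: "apolar_action P F = smult [:\<alpha>:] (X ^ (d - p))" "\<alpha> \<noteq> 0"
    and Q: "Q \<in> apolar_ideal F" "\<not> (\<exists>R. binary_form (q - 1) R \<and> Q = R * Y)"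
  shows "generates F (Suc p) (Y * P) q Q"
proof -
  have forms: "binary_form p P" "binary_form q Q"
    using gen by (auto simp: generates_def)
  obtain Q1 \<delta> where Q1: "Q = Y * Q1 + smult [:\<delta>:] (X ^ q)" "binary_form (q - 1) Q1"
    using binary_form_decomp[OF forms(2)] by blast
  have "\<delta> \<noteq> 0"
    using Q(2) Q1 by (auto simp: mult.commute)
  have "P * Y \<in> apolar_ideal F"
    using generates_mem(1)[OF gen] unfolding mult_in_apolar_ideal_iff apolar_action_Y .
  then have YP: "Y * P \<in> apolar_ideal F"
    by (simp add: mult.commute)
  have ex: "\<exists>u v. f = u * (Y * P) + v * Q" if f: "binary_form r f" "f \<in> apolar_ideal F" for r f
  proof -
    have "f * Y \<in> apolar_ideal F"
      using apolar_ideal_mult[OF f(2), of Y] by (simp add: mult.commute)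
    then have "f \<in> apolar_ideal (partial_y F)"
      unfolding mult_in_apolar_ideal_iff apolar_action_Y .
    then obtain u v where uv: "f = u * P + v * Q" "binary_form (r - p) u" "r < p \<longrightarrow> u = 0"
      using generatesD[OF gen f(1)] by metis
    obtain u1 \<gamma> where u1: "u = Y * u1 + smult [:\<gamma>:] (X ^ (r - p))"
      using binary_form_decomp[OF uv(2)] by metis
    have "apolar_action (u * P) F = apolar_action f F - apolar_action (v * Q) F"
      unfolding uv(1) apolar_action_add by simp
    also have "\<dots> = 0"
      using f(2) apolar_ideal_mult[OF Q(1), of v] by (simp add: apolar_ideal_iff)
    finally have "smult [:\<alpha>:] (apolar_action u (X ^ (d - p))) = 0"
      unfolding apolar_action_mult P(1) apolar_action_smult_right .
    then have act: "smult [:\<gamma>:] (apolar_action (X ^ (r - p)) (X ^ (d - p))) = 0"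
      using \<open>\<alpha> \<noteq> 0\<close> unfolding u1 apolar_action_add apolar_action_Y_mult_X_power
        apolar_action_smult by simp
    consider "\<gamma> = 0" | "\<gamma> \<noteq> 0" "d < r"
    proof (cases "r \<le> d")
      case True
      then have "r - p \<le> d - p" by simp
      from apolar_action_X_power[OF this] act have "\<gamma> = 0"
        by (auto simp: X_power)
      then show ?thesis using that by blast
    qed (use that in auto)
    then show ?thesis
    proof cases
      case 1
      then have "f = u1 * (Y * P) + v * Q"
        unfolding uv(1) u1 by (simp add: mult_ac)
      then show ?thesis by blast
    next
      case 2
      \<comment> \<open>From r > d = p + q - 1 it follows that r - p is at least q, so the pure
        power of x contains x^q. As \<open>\<delta>\<close> is nonzero, x^q is a combination of Q
        and a multiple of y.\<close>
      define k where "k = r - p - q"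
      have "r - p = k + q"
        using 2 \<open>p + q = d + 1\<close> by (simp add: k_def)
      then have Xr: "X ^ (r - p) = X ^ k * X ^ q"
        by (simp add: power_add)
      have "smult [:\<delta>:] (X ^ q) = Q - Y * Q1"
        unfolding Q1(1) by simp
      then have Xq: "X ^ q = smult [:1 / \<delta>:] (Q - Y * Q1)"
        using \<open>\<delta> \<noteq> 0\<close> by (rule smult_cancel)
      have "f = u1 * (Y * P) + smult [:\<gamma>:] (X ^ k * smult [:1 / \<delta>:] (Q - Y * Q1)) * P + v * Q"
        unfolding uv(1) u1 Xr Xq by (simp add: algebra_simps)
      also have "\<dots> = (u1 - [:[:\<gamma> / \<delta>:]:] * X ^ k * Q1) * (Y * P) + ([:[:\<gamma> / \<delta>:]:] * X ^ k * P + v) * Q"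
        by (simp add: algebra_simps smult_add_right smult_diff_right)
      finally show ?thesis by blast
    qed
  qed
  have "apolar_ideal F = {u * (Y * P) + v * Q | u v. True}"
    using F YP Q(1) ex by (rule apolar_ideal_eqI)
  moreover have "binary_form (Suc p) (Y * P)"
    using binary_form_mult[OF binary_form_Y forms(1)] by simp
  ultimately show ?thesis
    using forms(2) gen by (simp add: generates_def)
qed

lemma apolar_ideal_above_degree:
  assumes "binary_form d F" "binary_form r f" "d < r"
  shows "f \<in> apolar_ideal F"
  using apolar_action_form[OF assms(2,1)] assms(3) by (simp add: apolar_ideal_iff)

lemma binary_form_0_eq:
  assumes "binary_form 0 f"
  obtains c where "f = smult [:c:] 1"
proof -
  obtain f1 c where "f = Y * f1 + smult [:c:] (X ^ 0)" "f1 = 0"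
    using binary_form_decomp[OF assms] by metis
  then show ?thesis using that by simp
qed

text \<open>The powers x^(d+1) and y^(d+1) both kill F, so a single generator would divide both and
  be constant; but no nonzero constant kills F.\<close>

lemma not_generated_by_one:
  assumes "binary_form d F" "F \<noteq> 0" "binary_form a G" "G \<in> apolar_ideal F"
  shows "\<not> (\<forall>r f. binary_form r f \<longrightarrow> f \<in> apolar_ideal F \<longrightarrow> (\<exists>u. f = u * G))"
proof
  assume gen: "\<forall>r f. binary_form r f \<longrightarrow> f \<in> apolar_ideal F \<longrightarrow> (\<exists>u. f = u * G)"
  have "binary_form (Suc d) (X ^ Suc d)" "binary_form (Suc d) (Y ^ Suc d)"
    using binary_form_power[OF binary_form_X, of "Suc d"] binary_form_power[OF binary_form_Y, of "Suc d"]
    by simp_all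
  then have "\<exists>u. X ^ Suc d = u * G" "\<exists>u. Y ^ Suc d = u * G"
    using gen apolar_ideal_above_degree[OF assms(1)] by blast+
  then obtain u v where "u * G = X ^ Suc d" "v * G = Y ^ Suc d"
    by metis
  from common_divisor_of_powers[OF assms(3) this] have "a = 0" .
  then obtain \<gamma> where G: "G = smult [:\<gamma>:] 1"
    using binary_form_0_eq assms(3) by blast
  have "\<gamma> \<noteq> 0"
    using \<open>u * G = X ^ Suc d\<close> by (auto simp: G X_power)
  moreover have "smult [:\<gamma>:] F = 0"
    using assms(4) unfolding G apolar_ideal_iff apolar_action_smult by simp
  ultimately show False
    using \<open>F \<noteq> 0\<close> by simp
qed

lemma binary_form_diff_mult_X_power:
  assumes "binary_form a G" "binary_form b H" "a \<le> b"
  shows "binary_form b (H - smult [:c:] (X ^ (b - a)) * G)"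
  using binary_form_mult[OF binary_form_smult[OF binary_form_X_power] assms(1), of "b - a" c] assms
  by (simp add: binary_form_diff)

lemma in_ideal_partial_y:
  assumes "R * Y \<in> apolar_ideal F"
  shows "R \<in> apolar_ideal (partial_y F)"
  using assms unfolding mult_in_apolar_ideal_iff apolar_action_Y .

text \<open>Here F is a multiple of x^d, so an apolar form of degree at most d contains no pure
  power of x and is divisible by y. This serves the base case and the step with vanishing
  y-derivative.\<close>

lemma generators_partial_y_0:
  assumes "binary_form d F" "F \<noteq> 0" "partial_y F = 0"
  shows "generates F 1 Y (Suc d) (X ^ Suc d)"
proof -
  obtain c where F: "F = smult [:c:] (X ^ d)"
    using partial_y_eq_0[OF assms(1,3)] .
  then have "c \<noteq> 0"
    using assms(2) by auto
  have "apolar_ideal F = {u * Y + v * X ^ Suc d | u v. True}"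
  proof (rule apolar_ideal_eqI[OF assms(1)])
    show "Y \<in> apolar_ideal F"
      unfolding apolar_ideal_iff apolar_action_Y by (rule assms(3))
    show "X ^ Suc d \<in> apolar_ideal F"
      by (rule apolar_ideal_above_degree[OF assms(1) binary_form_X_power]) simp
    fix r f
    assume f: "binary_form r f" "f \<in> apolar_ideal F"
    obtain f1 \<gamma> where f1: "f = Y * f1 + smult [:\<gamma>:] (X ^ r)"
      using binary_form_decomp[OF f(1)] by metis
    have "smult [:c:] (apolar_action f (X ^ d)) = 0"
      using f(2) unfolding apolar_ideal_iff F apolar_action_smult_right .
    then have act: "smult [:\<gamma>:] (apolar_action (X ^ r) (X ^ d)) = 0"
      using \<open>c \<noteq> 0\<close> unfolding f1 apolar_action_add apolar_action_Y_mult_X_power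
        apolar_action_smult by simp
    show "\<exists>u v. f = u * Y + v * X ^ Suc d"
    proof (cases "r \<le> d")
      case True
      from apolar_action_X_power[OF True] act have "\<gamma> = 0"
        by (auto simp: X_power)
      then have "f = f1 * Y + 0 * X ^ Suc d"
        unfolding f1 by (simp add: mult.commute)
      then show ?thesis by blast
    next
      case False
      then have "X ^ r = X ^ (r - Suc d) * X ^ Suc d"
        by (simp only: flip: power_add) simp
      then have "f = f1 * Y + smult [:\<gamma>:] (X ^ (r - Suc d)) * X ^ Suc d"
        unfolding f1 mult_smult_left by (simp add: mult.commute)
      then show ?thesis by blast
    qed
  qed
  then show ?thesis
    unfolding generates_def by (intro conjI binary_form_Y binary_form_X_power) (simp_all add: X_power)
qed

lemma generators_exist:
  assumes "binary_form d F" "F \<noteq> 0"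
  shows "\<exists>a G b H. generates F a G b H \<and> a + b = d + 2"
  using assms
proof (induction d arbitrary: F)
  case (0 F)
  then have "generates F 1 Y (Suc 0) (X ^ Suc 0)"
    by (intro generators_partial_y_0 partial_y_binary_form_0)
  then show ?case by (intro exI conjI) auto
next
  case (Suc d)
  show ?case
  proof (cases "partial_y F = 0")
    case True
    have "generates F 1 Y (Suc (Suc d)) (X ^ Suc (Suc d))"
      by (rule generators_partial_y_0[OF Suc.prems True])
    then show ?thesis by (intro exI conjI) auto
  next
    case False
    define F' where "F' = partial_y F"
    have F': "binary_form d F'"
      using binary_form_partial_y[OF Suc.prems(1)] by (simp add: F'_def)
    from Suc.IH[OF this] False obtain a G b H
      where gen0: "generates F' a G b H" and "a + b = d + 2"
      by (auto simp: F'_def)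
    moreover from gen0 have "generates F' b H a G"
      by (rule generates_commute)
    ultimately have "\<exists>a G b H. generates F' a G b H \<and> a + b = d + 2 \<and> a \<le> b"
      by (metis add.commute nat_le_linear)
    then obtain a G b H
      where gen: "generates F' a G b H" and ab: "a + b = d + 2" "a \<le> b"
      by blast
    then have forms: "binary_form a G" "binary_form b H" "G \<noteq> 0" "H \<noteq> 0"
      by (simp_all add: generates_def)
    note mem = generates_mem[OF gen]
    have "a \<noteq> 0"
    proof
      assume "a = 0"
      then obtain \<gamma> where G: "G = smult [:\<gamma>:] 1"
        using binary_form_0_eq forms(1) by blast
      then show False
        using mem(1) False \<open>G \<noteq> 0\<close> by (simp add: apolar_ideal_iff apolar_action_pCons F'_def)
    qed
    have killed: "\<exists>\<alpha>. apolar_action f F = smult [:\<alpha>:] (X ^ (Suc d - r))"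
      if "binary_form r f" "f \<in> apolar_ideal F'" for r f
    proof -
      have "partial_y (apolar_action f F) = 0"
        using that(2) by (simp add: apolar_ideal_iff F'_def apolar_action_partial_y)
      then show ?thesis
        using partial_y_eq_0 apolar_action_form[OF that(1) Suc.prems(1)] by metis
    qed
    obtain \<alpha> where \<alpha>: "apolar_action G F = smult [:\<alpha>:] (X ^ (Suc d - a))"
      using killed forms(1) mem(1) by blast
    obtain \<beta> where \<beta>: "apolar_action H F = smult [:\<beta>:] (X ^ (Suc d - b))"
      using killed forms(2) mem(2) by blast
    show ?thesis
    proof (cases "\<alpha> = 0")
      case True
      then have GF: "G \<in> apolar_ideal F"
        using \<alpha> by (simp add: apolar_ideal_iff)
      \<comment> \<open>If both generators killed F, so would every form of the degree of F, against
        nondegeneracy of the pairing.\<close>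
      have "\<beta> \<noteq> 0"
      proof
        assume "\<beta> = 0"
        then have HF: "H \<in> apolar_ideal F"
          using \<beta> by (simp add: apolar_ideal_iff)
        have "f \<in> apolar_ideal F" if "binary_form (Suc d) f" for f
        proof -
          have "f \<in> apolar_ideal F'"
            using apolar_ideal_above_degree[OF F' that] by simp
          then obtain u v where "f = u * G + v * H"
            using gen unfolding generates_def by blast
          then show ?thesis
            using GF HF by (simp add: apolar_ideal_add apolar_ideal_mult)
        qed
        from apolar_ideal_eq_0I[OF Suc.prems(1) this] show False
          using Suc.prems(2) by blast
      qed
      \<comment> \<open>If y divided G, the quotient would be apolar to \<open>F'\<close> while
        having smaller degree than both generators.\<close>
      have "\<not> (\<exists>R. binary_form (a - 1) R \<and> G = R * Y)"
      proof
        assume "\<exists>R. binary_form (a - 1) R \<and> G = R * Y"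
        then obtain R where R: "binary_form (a - 1) R" "G = R * Y"
          by blast
        then have "R \<in> apolar_ideal F'"
          using GF in_ideal_partial_y unfolding F'_def by blast
        then obtain u v where "R = u * G + v * H" "a - 1 < a \<longrightarrow> u = 0" "a - 1 < b \<longrightarrow> v = 0"
          using generatesD[OF gen R(1)] by blast
        then have "R = 0"
          using \<open>a \<noteq> 0\<close> ab by simp
        with R(2) forms(3) show False by simp
      qed
      from generates_partial_y[OF Suc.prems(1) generates_commute[OF gen, unfolded F'_def] _ _ \<beta> \<open>\<beta> \<noteq> 0\<close> GF this]
      have "generates F (Suc b) (Y * H) a G"
        using ab \<open>a \<noteq> 0\<close> by simp
      moreover have "Suc b + a = Suc d + 2"
        using ab by simp
      ultimately show ?thesis by blast
    next
      case False
      have "b - a \<le> Suc d - a"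
        using ab \<open>a \<noteq> 0\<close> by simp
      from apolar_action_X_power[OF this] obtain c where c: "c \<noteq> 0"
        "apolar_action (X ^ (b - a)) (X ^ (Suc d - a)) = smult [:c:] (X ^ (Suc d - a - (b - a)))"
        by blast
      \<comment> \<open>The form x^(b-a) * G sends F to \<open>\<alpha> * c\<close> times the same
        power of x that occurs in \<open>\<beta>\<close>, so this factor makes K kill F.\<close>
      define \<kappa> where "\<kappa> = \<beta> / (\<alpha> * c)"
      define K where "K = H - smult [:\<kappa>:] (X ^ (b - a)) * G"
      have K: "binary_form b K"
        using forms ab unfolding K_def by (intro binary_form_diff_mult_X_power)
      define T where "T = smult [:\<kappa>:] (X ^ (b - a))"
      have H: "H = K + T * G"
        by (simp add: K_def T_def)
      have comb: "\<exists>u v. f = u * G + v * K" if f: "f \<in> apolar_ideal F'" for f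
      proof -
        obtain u v where "f = u * G + v * H"
          using f gen unfolding generates_def by blast
        then have "f = (u + v * T) * G + v * K"
          unfolding H by (simp only: algebra_simps)
        then show ?thesis by blast
      qed
      have "K = H + (- T) * G"
        by (simp add: H)
      then have KF': "K \<in> apolar_ideal F'"
        using apolar_ideal_add[OF mem(2) apolar_ideal_mult[OF mem(1), of "- T"]] by (simp only:)
      have "apolar_action (T * G) F =
          smult [:\<kappa> * (\<alpha> * c):] (X ^ (Suc d - a - (b - a)))"
        unfolding T_def apolar_action_mult \<alpha> apolar_action_smult apolar_action_smult_right c
        by (simp add: mult_ac)
      also have "Suc d - a - (b - a) = Suc d - b"
        using ab by simp
      also have "smult [:\<kappa> * (\<alpha> * c):] (X ^ (Suc d - b)) = apolar_action H F"
        using False \<open>c \<noteq> 0\<close> unfolding \<beta> by (simp add: \<kappa>_def)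
      finally have "apolar_action K F = 0"
        using H by (simp add: apolar_action_add)
      then have KF: "K \<in> apolar_ideal F"
        by (simp add: apolar_ideal_iff)
      \<comment> \<open>If y divided K, the quotient would be apolar to \<open>F'\<close> in degree
        b - 1, hence a multiple of G. Then K would be one too, and G alone would generate the ideal
        of \<open>F'\<close>.\<close>
      have notY: "\<not> (\<exists>R. binary_form (b - 1) R \<and> K = R * Y)"
      proof
        assume "\<exists>R. binary_form (b - 1) R \<and> K = R * Y"
        then obtain R where R: "binary_form (b - 1) R" "K = R * Y"
          by blast
        then have "R \<in> apolar_ideal F'"
          using KF in_ideal_partial_y unfolding F'_def by blast
        then obtain u v where "R = u * G + v * K"
          using comb by blast
        then obtain u v where "R = u * G + v * K" "b - 1 < b \<longrightarrow> v = 0"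
          using form_combination[OF R(1) forms(1) K] by metis
        then have "R = u * G"
          using \<open>a \<noteq> 0\<close> ab by simp
        then have KG: "K = (u * Y) * G"
          using R(2) by simp
        have "\<exists>w. f = w * G" if "f \<in> apolar_ideal F'" for f
          using comb[OF that] unfolding KG mult.assoc[symmetric] distrib_right[symmetric] by blast
        with not_generated_by_one[OF F' _ forms(1) mem(1)] \<open>partial_y F \<noteq> 0\<close> show False
          by (auto simp: F'_def)
      qed
      have "K \<noteq> 0"
        using notY by (metis binary_form_0 mult_zero_left)
      have "apolar_ideal F' = {u * G + v * K | u v. True}"
        using comb mem(1) KF' by (auto intro: apolar_ideal_add apolar_ideal_mult)
      then have "generates F' a G b K"
        using forms K \<open>K \<noteq> 0\<close> by (simp add: generates_def)
      from generates_partial_y[OF Suc.prems(1) this[unfolded F'_def] _ _ \<alpha> False KF notY]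
      have "generates F (Suc a) (Y * G) b K"
        using ab \<open>a \<noteq> 0\<close> by simp
      moreover have "Suc a + b = Suc d + 2"
        using ab by simp
      ultimately show ?thesis by blast
    qed
  qed
qed

section \<open>Linear factors of binary forms\<close>

definition ev :: "real poly poly \<Rightarrow> real \<Rightarrow> real \<Rightarrow> real" where
  "ev g s t = poly (poly g [:t:]) s"

text \<open>The linear form p x + q y. Its zero on the projective line is (q : -p), the point at
  which divisibility is tested below.\<close>

definition lin :: "real \<Rightarrow> real \<Rightarrow> real poly poly" where
  "lin p q = [:[:0, p:], [:q:]:]"

lemma ev_simps [simp]:
  "ev 0 s t = 0" "ev 1 s t = 1" "ev X s t = s" "ev Y s t = t"
  "ev (f + g) s t = ev f s t + ev g s t" "ev (f - g) s t = ev f s t - ev g s t"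
  "ev (f * g) s t = ev f s t * ev g s t" "ev (f ^ n) s t = ev f s t ^ n"
  "ev (smult a f) s t = poly a s * ev f s t" "ev (pCons a f) s t = poly a s + t * ev f s t"
  "ev (lin p q) s t = p * s + q * t"
  by (simp_all add: ev_def lin_def)

lemma linear_form_iff: "linear_form l \<longleftrightarrow> (\<exists>p q. l = lin p q \<and> (p \<noteq> 0 \<or> q \<noteq> 0))"
proof
  assume l: "linear_form l"
  then obtain f1 p where f1: "l = Y * f1 + smult [:p:] (X ^ 1)" "binary_form 0 f1"
    using binary_form_decomp[of 1 l] by (auto simp: linear_form_def)
  then obtain q where "f1 = smult [:q:] 1"
    using binary_form_0_eq by blast
  with f1 have "l = lin p q"
    by (simp add: lin_def one_pCons)
  with l show "\<exists>p q. l = lin p q \<and> (p \<noteq> 0 \<or> q \<noteq> 0)"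
    by (auto simp: linear_form_def lin_def)
next
  assume "\<exists>p q. l = lin p q \<and> (p \<noteq> 0 \<or> q \<noteq> 0)"
  then show "linear_form l"
    by (auto simp: linear_form_def lin_def binary_form_def coeff_pCons split: nat.splits)
qed

lemma linear_form_lin: "p \<noteq> 0 \<or> q \<noteq> 0 \<Longrightarrow> linear_form (lin p q)"
  by (auto simp: linear_form_iff)

lemma form_induct [consumes 1, case_names const step]:
  assumes "binary_form r f"
    and "\<And>c. P 0 (smult [:c:] 1)"
    and "\<And>r f c. binary_form r f \<Longrightarrow> P r f \<Longrightarrow> P (Suc r) (Y * f + smult [:c:] (X ^ Suc r))"
  shows "P r f"
  using assms(1)
proof (induction r arbitrary: f)
  case 0
  then show ?case
    using binary_form_0_eq assms(2) by metis
next
  case (Suc r)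
  then show ?case
    using binary_form_decomp[OF Suc.prems] assms(3) by (metis diff_Suc_1)
qed

lemma ev_scale: "binary_form r f \<Longrightarrow> ev f (c * s) (c * t) = c ^ r * ev f s t"
  by (induction rule: form_induct) (simp_all add: algebra_simps power_mult_distrib)

lemma ev_at_0: "binary_form r f \<Longrightarrow> ev f 0 t = coeff (coeff f r) 0 * t ^ r"
  by (induction rule: form_induct) (simp_all add: X_power coeff_1 poly_monom)

text \<open>Substituting y = \<open>\<kappa>\<close> x makes every monomial a multiple of x^r. A
  zero of f at (1, \<open>\<kappa>\<close>) is therefore a root of f as a polynomial in y over
  R[x].\<close>

lemma poly_form_linear: "binary_form r f \<Longrightarrow> poly f [:0, \<kappa>:] = monom (ev f 1 \<kappa>) r"
proof (induction rule: form_induct)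
  case (step r f c)
  have "[:0, \<kappa>:] * monom a r = monom (\<kappa> * a) (Suc r)" for a
    by (simp add: monom_Suc smult_monom)
  moreover have "[:c:] * monom 1 n = monom c n" for n
    by (simp add: smult_monom)
  ultimately show ?case using step
    by (simp add: X_power smult_monom add_monom poly_monom del: power_Suc mult_pCons_left)
qed (simp add: monom_0)

text \<open>Factor theorem for forms. If q = 0 the linear form is a multiple of x, and vanishing at
  the point removes the only monomial without x. Otherwise the point is scaled to first coordinate 1
  and the univariate factor theorem over R[x] applies.\<close>

lemma lin_dvd_iff:
  assumes g: "binary_form r g" and "p \<noteq> 0 \<or> q \<noteq> 0"
  shows "lin p q dvd g \<longleftrightarrow> ev g q (- p) = 0"
proof
  assume "lin p q dvd g"
  then show "ev g q (- p) = 0"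
    by (auto elim!: dvdE)
next
  assume 0: "ev g q (- p) = 0"
  show "lin p q dvd g"
  proof (cases "q = 0")
    case True
    with assms 0 have "coeff (coeff g r) 0 = 0"
      by (simp add: ev_at_0)
    with g have "coeff (coeff g j) 0 = 0" for j
      by (cases "j = r") (auto simp: binary_formD)
    then have "[:0, 1:] dvd coeff g j" for j
      using poly_eq_0_iff_dvd[of "coeff g j" 0] by (simp add: poly_0_coeff_0)
    then have "X dvd g"
      by (simp add: const_poly_dvd_iff)
    moreover have "X = lin p q * [:[:1 / p:]:]"
      using True assms(2) by (simp add: lin_def)
    ultimately show ?thesis
      by (metis dvd_mult_left)
  next
    case False
    have "ev g 1 (- p / q) = 0"
      using ev_scale[OF g, of "1 / q" q "- p"] 0 False by simp
    then have "poly g [:0, - p / q:] = 0"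
      using poly_form_linear[OF g] by simp
    then have "[:- [:0, - p / q:], 1:] dvd g"
      using poly_eq_0_iff_dvd by blast
    moreover have "[:- [:0, - p / q:], 1:] = lin p q * [:[:1 / q:]:]"
      using False by (simp add: lin_def one_pCons)
    ultimately show ?thesis
      by (metis dvd_mult_left)
  qed
qed

lemma linear_formE:
  assumes "linear_form l"
  obtains p q where "l = lin p q" "\<And>r g. binary_form r g \<Longrightarrow> l dvd g \<longleftrightarrow> ev g q (- p) = 0"
    "p \<noteq> 0 \<or> q \<noteq> 0"
  using assms lin_dvd_iff unfolding linear_form_iff by metis

text \<open>Linear forms behave as primes because divisibility by one is vanishing at a point, and
  evaluation is multiplicative.\<close>

lemma linear_form_dvd_mult:
  assumes "linear_form l" "binary_form r f" "binary_form s g" "l dvd f * g"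
  shows "l dvd f \<or> l dvd g"
proof -
  obtain p q where dvd: "\<And>r g. binary_form r g \<Longrightarrow> l dvd g \<longleftrightarrow> ev g q (- p) = 0"
    using linear_formE[OF assms(1)] by metis
  have "ev (f * g) q (- p) = 0"
    using dvd[OF binary_form_mult[OF assms(2,3)]] assms(4) by blast
  then show ?thesis
    using dvd[OF assms(2)] dvd[OF assms(3)] by simp
qed

lemma linear_form_dvd_linear_form:
  assumes "linear_form l" "linear_form m" "l dvd m"
  shows "\<exists>c. m = smult [:c:] l"
proof -
  obtain k where k: "m = k * l"
    using assms(3) by (metis dvd_def mult.commute)
  have "m \<noteq> 0" "k \<noteq> 0" "l \<noteq> 0" "binary_form 1 l" "binary_form 1 (k * l)"
    using assms k by (auto simp: linear_form_def)
  then have "binary_form (1 - 1) k"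
    using binary_form_cofactor by metis
  then have "binary_form 0 k"
    by simp
  then obtain c where "k = smult [:c:] 1"
    using binary_form_0_eq by blast
  then show ?thesis
    using k by auto
qed

lemma linear_form_dvdE:
  assumes "linear_form l" "binary_form r f" "f \<noteq> 0" "l dvd f"
  obtains s h where "r = Suc s" "f = l * h" "binary_form s h" "h \<noteq> 0"
proof -
  obtain h where h: "f = h * l"
    using assms(4) by (metis dvd_def mult.commute)
  then have "1 \<le> r" "binary_form (r - 1) h"
    using binary_form_cofactor[of 1 l r h] assms by (auto simp: linear_form_def)
  with that[of "r - 1" h] h assms(3) show ?thesis
    by (auto simp: mult.commute)
qed

text \<open>Dividing out one factor lowers the degree by one, and the others, not proportional to
  it, still divide the quotient.\<close>

lemma card_linear_factors_le:
  assumes "finite L" "binary_form e u" "u \<noteq> 0"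
    and "\<And>l. l \<in> L \<Longrightarrow> linear_form l \<and> l dvd u"
    and "pairwise (\<lambda>l m. \<forall>c. m \<noteq> smult [:c:] l) L"
  shows "card L \<le> e"
  using assms
proof (induction L arbitrary: e u rule: finite_induct)
  case (insert m L)
  have "linear_form m" "m dvd u"
    using insert.prems(3) by simp_all
  then obtain e' u' where u': "e = Suc e'" "u = m * u'" "binary_form e' u'" "u' \<noteq> 0"
    using linear_form_dvdE[of m e u] insert.prems(1,2) by blast
  have "linear_form l \<and> l dvd u'" if l: "l \<in> L" for l
  proof -
    have lm: "linear_form l" "linear_form m" "l dvd m * u'"
      using insert.prems(3) l u'(2) by auto
    have "\<not> l dvd m"
      using linear_form_dvd_linear_form[OF lm(1,2)] insert.prems(4) insert.hyps(2) l
      by (auto simp: pairwise_insert)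
    with lm show ?thesis
      using linear_form_dvd_mult u'(3) unfolding linear_form_def by blast
  qed
  from insert.IH[OF u'(3,4) this] insert.prems(4) have "card L \<le> e'"
    by (simp add: pairwise_insert)
  with insert.hyps u'(1) show ?case by simp
qed simp

section \<open>Dehomogenization to univariate polynomials\<close>

definition dehom :: "real poly poly \<Rightarrow> real poly" where
  "dehom g = map_poly (\<lambda>c. poly c 1) g"

lemma coeff_dehom: "coeff (dehom g) j = poly (coeff g j) 1"
  by (simp add: dehom_def coeff_map_poly)

lemma poly_dehom [simp]: "poly (dehom g) t = ev g 1 t"
proof (induction g)
  case (pCons c g)
  have "dehom (pCons c g) = pCons (poly c 1) (dehom g)"
    by (intro poly_eqI) (simp add: coeff_dehom coeff_pCons split: nat.splits)
  with pCons show ?case by (simp add: ev_def)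
qed (simp add: dehom_def)

lemma poly_form_coeff_at_1:
  assumes "binary_form r g" "j \<le> r"
  shows "poly (coeff g j) 1 = coeff (coeff g j) (r - j)"
proof -
  have "coeff g j = monom (coeff (coeff g j) (r - j)) (r - j)"
    using binary_formD[OF assms(1)] assms(2) by (intro poly_eqI) auto
  then have "poly (coeff g j) 1 = poly (monom (coeff (coeff g j) (r - j)) (r - j)) 1"
    by (rule arg_cong)
  then show ?thesis
    by (simp add: poly_monom)
qed

lemma dehom_eq_0:
  assumes "binary_form r g" "dehom g = 0"
  shows "g = 0"
proof -
  have "coeff (coeff g j) i = 0" for i j
  proof (cases "i + j = r")
    case True
    then show ?thesis
      using poly_form_coeff_at_1[OF assms(1), of j] coeff_dehom[of g j] assms(2) by auto
  qed (use assms in \<open>simp add: binary_formD\<close>)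
  then show ?thesis
    by (metis coeff_0 poly_eqI)
qed

lemma degree_dehom_le:
  assumes "binary_form r g"
  shows "degree (dehom g) \<le> r"
proof (intro degree_le allI impI)
  fix j
  assume "r < j"
  then have "coeff g j = 0"
    using assms by (intro poly_eqI) (simp add: binary_formD)
  then show "coeff (dehom g) j = 0"
    by (simp add: coeff_dehom)
qed

section \<open>Real cubic forms\<close>

lemma cubic_has_root:
  fixes p :: "real poly"
  assumes "degree p = 3"
  shows "\<exists>x. poly p x = 0"
proof -
  have *: "\<exists>x. poly p x = 0" if p: "degree p = 3" "lead_coeff p > 0" for p :: "real poly"
  proof -
    obtain a where a: "\<And>x. x \<ge> a \<Longrightarrow> poly p x \<ge> lead_coeff p"
      using poly_pinfty_gt_lc[OF p(2)] by blast
    \<comment> \<open>The polynomial -p(-x) has the same leading coefficient because the degree is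
      odd, so p is negative far to the left as well as positive far to the right.\<close>
    define q where "q = - pcompose p [:0, -1:]"
    have "lead_coeff q = lead_coeff p"
      using p by (simp add: q_def lead_coeff_comp del: pcompose_pCons)
    then obtain b where b: "\<And>x. x \<ge> b \<Longrightarrow> poly q x \<ge> lead_coeff p"
      using poly_pinfty_gt_lc[of q] p(2) by auto
    define c where "c = max (max a b) 1"
    have c: "c \<ge> a" "c \<ge> b" "c \<ge> 1"
      by (simp_all add: c_def)
    have "poly p (- c) < 0"
      using b[OF c(2)] p(2) by (simp add: q_def poly_pcompose)
    moreover have "poly p c > 0"
      using a[OF c(1)] p(2) by simp
    ultimately show ?thesis
      using poly_IVT_pos[of "- c" c p] c(3) by auto
  qed
  show ?thesis
  proof (cases "lead_coeff p > 0")
    case False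
    moreover have "p \<noteq> 0"
      using assms by auto
    then have "lead_coeff p \<noteq> 0"
      by (rule leading_coeff_neq_0)
    ultimately have "lead_coeff p < 0"
      by linarith
    then have "lead_coeff (- p) > 0"
      by simp
    with *[of "- p"] assms show ?thesis by simp
  qed (use * assms in blast)
qed

text \<open>Either the coefficient of y^3 vanishes and x divides the form, or setting x = 1 leaves a
  real polynomial of degree exactly 3.\<close>

lemma cubic_form_linear_factor:
  assumes "binary_form 3 c"
  shows "\<exists>l. linear_form l \<and> l dvd c"
proof (cases "coeff (coeff c 3) 0 = 0")
  case True
  then have "ev c 0 (- 1) = 0"
    using ev_at_0[OF assms] by simp
  then have "lin 1 0 dvd c"
    using lin_dvd_iff[OF assms] by auto
  then show ?thesis
    using linear_form_lin[of 1 0] by auto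
next
  case False
  then have "coeff (dehom c) 3 \<noteq> 0"
    using poly_form_coeff_at_1[OF assms, of 3] by (simp add: coeff_dehom)
  then have "degree (dehom c) = 3"
    using degree_dehom_le[OF assms] le_degree by (metis le_antisym)
  then obtain t where "ev c 1 t = 0"
    using cubic_has_root by fastforce
  then have "lin (- t) 1 dvd c"
    using lin_dvd_iff[OF assms, of "- t" 1] by simp
  then show ?thesis
    using linear_form_lin[of "- t" 1] by auto
qed

text \<open>Real cube roots absorb the scalar. This turns statements valid up to scale into equality
  with an exact cube.\<close>

lemma smult_cube_is_cube:
  assumes "linear_form l" "c \<noteq> 0"
  shows "\<exists>m. linear_form m \<and> smult [:c:] (l ^ 3) = m ^ 3"
proof (intro exI conjI)
  show "linear_form (smult [:root 3 c:] l)"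
    using assms by (simp add: linear_form_def binary_form_smult)
  have "root 3 c ^ 3 = c"
    by (simp add: odd_real_root_pow)
  then have "[:root 3 c:] ^ 3 = [:c:]"
    by (simp add: poly_const_pow)
  then show "smult [:c:] (l ^ 3) = smult [:root 3 c:] l ^ 3"
    by (simp only: smult_power)
qed

text \<open>Without a simple factor, l^2 divides c for some l with linear cofactor m. Since m^2 also
  divides c, the forms m and l are proportional, and c is a scalar times m^3, hence a cube.\<close>

lemma cubic_form_simple_factor:
  assumes c: "binary_form 3 c" "c \<noteq> 0" and not_cube: "\<And>m. linear_form m \<Longrightarrow> c \<noteq> m ^ 3"
  shows "\<exists>l. linear_form l \<and> l dvd c \<and> \<not> l ^ 2 dvd c"
proof (rule ccontr)
  assume neg: "\<not> ?thesis"
  obtain l where l: "linear_form l" "l dvd c"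
    using cubic_form_linear_factor[OF c(1)] by blast
  then have "l \<noteq> 0" "binary_form 1 l"
    by (simp_all add: linear_form_def)
  from neg l have "l ^ 2 dvd c" by blast
  then obtain m where m: "c = m * l ^ 2"
    by (metis dvd_def mult.commute)
  have "binary_form (3 - 2) m"
    using binary_form_cofactor[of 2 "l ^ 2" 3 m] binary_form_power[OF \<open>binary_form 1 l\<close>, of 2] c m
    by auto
  with m c have lm: "linear_form m"
    by (auto simp: linear_form_def)
  moreover from m have "m dvd c" by simp
  ultimately have "m ^ 2 dvd c"
    using neg by blast
  then have "m dvd l ^ 2"
    using c(2) unfolding m power2_eq_square by (auto simp: dvd_mult_cancel_left)
  then have "m dvd l"
    using linear_form_dvd_mult[OF lm \<open>binary_form 1 l\<close> \<open>binary_form 1 l\<close>]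
    by (auto simp: power2_eq_square)
  then obtain k where k: "l = smult [:k:] m"
    using linear_form_dvd_linear_form lm l(1) by blast
  then have "c = smult [:k * k:] (m ^ 3)"
    using m by (simp add: power2_eq_square power3_eq_cube mult.commute)
  moreover have "k * k \<noteq> 0"
    using k \<open>l \<noteq> 0\<close> by auto
  ultimately show False
    using smult_cube_is_cube[OF lm] not_cube by metis
qed

section \<open>Apolar forms with almost real roots\<close>

text \<open>In case of equality neither polynomial is constant, since otherwise both would be. The
  leading coefficients of the two sides are then the same product times deg q and deg p
  respectively.\<close>

lemma wronskian_nonzero_degree:
  fixes p q :: "real poly"
  assumes "p \<noteq> 0" "q \<noteq> 0" "degree p \<noteq> degree q"
  shows "p * pderiv q \<noteq> pderiv p * q"
proof
  assume eq: "p * pderiv q = pderiv p * q"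
  then have "pderiv p = 0 \<longleftrightarrow> pderiv q = 0"
    using assms by (metis mult_eq_0_iff)
  then have deg: "degree p \<noteq> 0" "degree q \<noteq> 0"
    using assms(3) unfolding pderiv_eq_0_iff by metis+
  have lc: "lead_coeff (pderiv r) = of_nat (degree r) * lead_coeff r" if "degree r \<noteq> 0" for r :: "real poly"
    using that by (cases "degree r") (simp_all add: degree_pderiv coeff_pderiv)
  have "lead_coeff p * (of_nat (degree q) * lead_coeff q) = of_nat (degree p) * lead_coeff p * lead_coeff q"
    using arg_cong[OF eq, of lead_coeff] by (simp add: lead_coeff_mult lc deg)
  with assms show False
    by simp
qed

text \<open>If it vanished, the degrees would agree. Subtracting the multiple of q that cancels the
  leading term keeps the Wronskian with q zero, so the difference would again have the degree of q,
  although its coefficient there is 0.\<close>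

lemma wronskian_nonzero:
  fixes p q :: "real poly"
  assumes indep: "\<And>\<alpha> \<beta>. smult \<alpha> p + smult \<beta> q = 0 \<Longrightarrow> \<alpha> = 0 \<and> \<beta> = 0"
  shows "p * pderiv q - pderiv p * q \<noteq> 0"
proof
  assume "p * pderiv q - pderiv p * q = 0"
  then have eq: "p * pderiv q = pderiv p * q"
    by simp
  have "p \<noteq> 0" "q \<noteq> 0"
    using indep[of 1 0] indep[of 0 1] by auto
  with eq have deg: "degree p = degree q"
    using wronskian_nonzero_degree by blast
  define c where "c = lead_coeff p / lead_coeff q"
  define p2 where "p2 = p - smult c q"
  have "p2 \<noteq> 0"
    using indep[of 1 "- c"] by (auto simp: p2_def)
  moreover have "p2 * pderiv q = pderiv p2 * q"
    using eq by (simp add: p2_def algebra_simps pderiv_diff pderiv_smult)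
  ultimately have "degree p2 = degree q"
    using wronskian_nonzero_degree \<open>q \<noteq> 0\<close> by blast
  moreover have "coeff p2 (degree q) = 0"
    using \<open>q \<noteq> 0\<close> deg by (simp add: p2_def c_def)
  ultimately show False
    using \<open>p2 \<noteq> 0\<close> by (metis leading_coeff_0_iff)
qed

lemma poly_pderiv_double_root:
  fixes A B :: "real poly"
  assumes "poly A t = 0"
  shows "poly (pderiv (A * A * B)) t = 0"
  using assms by (simp add: pderiv_mult)

lemma dehom_eqI: "(\<And>t. ev f 1 t = poly p t) \<Longrightarrow> dehom f = p"
  by (intro poly_ext) simp

lemma dehom_mult: "dehom (f * g) = dehom f * dehom g"
  by (intro dehom_eqI) simp

lemma dehom_combination:
  "dehom (smult [:\<alpha>:] f + smult [:\<beta>:] g) = smult \<alpha> (dehom f) + smult \<beta> (dehom g)"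
  by (intro dehom_eqI) simp

text \<open>The projective line splits into (0 : 1) and the points (1 : t). The latter are those
  visible after dehomogenization.\<close>

lemma linear_form_root_cases:
  assumes "linear_form m"
  obtains "\<And>r f. binary_form r f \<Longrightarrow> m dvd f \<longleftrightarrow> ev f 0 1 = 0"
  | t where "\<And>r f. binary_form r f \<Longrightarrow> m dvd f \<longleftrightarrow> ev f 1 t = 0"
proof -
  obtain p q where pq: "p \<noteq> 0 \<or> q \<noteq> 0"
    and dvd: "\<And>r g. binary_form r g \<Longrightarrow> m dvd g \<longleftrightarrow> ev g q (- p) = 0"
    using linear_formE[OF assms] by metis
  show ?thesis
  proof (cases "q = 0")
    case True
    have "m dvd f \<longleftrightarrow> ev f 0 1 = 0" if "binary_form r f" for r f
      using dvd[OF that] ev_scale[OF that, of "- p" 0 1] pq True by simp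
    then show ?thesis using that(1) by blast
  next
    case False
    have "m dvd f \<longleftrightarrow> ev f 1 (- p / q) = 0" if "binary_form r f" for r f
      using dvd[OF that] ev_scale[OF that, of q 1 "- p / q"] False by simp
    then show ?thesis using that(2) by blast
  qed
qed

text \<open>Without base points, each real point lies on one member of the pencil up to scale.
  Members with a multiple real factor or a real factor in common with b pass through one of finitely
  many exceptional points. It suffices to take the member through a point that avoids the finitely
  many zeros of the members through these.\<close>

lemma pencil_member:
  assumes G: "binary_form k G" and H: "binary_form k H" and b: "binary_form e b" "b \<noteq> 0"
    and indep: "\<And>\<alpha> \<beta>. smult [:\<alpha>:] G + smult [:\<beta>:] H = 0 \<Longrightarrow> \<alpha> = 0 \<and> \<beta> = 0"
    and base_point_free: "\<And>s t. s \<noteq> 0 \<or> t \<noteq> 0 \<Longrightarrow> ev G s t \<noteq> 0 \<or> ev H s t \<noteq> 0"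
  shows "\<exists>\<alpha> \<beta> g l. g = smult [:\<alpha>:] G + smult [:\<beta>:] H \<and> g \<noteq> 0 \<and> linear_form l \<and> l dvd g \<and>
    (\<forall>m. linear_form m \<longrightarrow> m dvd g \<longrightarrow> \<not> m ^ 2 dvd g \<and> \<not> m dvd b)"
proof -
  define w where "w = dehom G * pderiv (dehom H) - pderiv (dehom G) * dehom H"
  \<comment> \<open>The member of the pencil that vanishes at (s, t).\<close>
  define member where "member s t = smult [:ev H s t:] G + smult [:- ev G s t:] H" for s t
  have member_form: "binary_form k (member s t)" for s t
    unfolding member_def using G H by (intro binary_form_add binary_form_smult)
  have member_nz: "member s t \<noteq> 0" if "s \<noteq> 0 \<or> t \<noteq> 0" for s t
    using indep[of "ev H s t" "- ev G s t"] base_point_free[OF that] by (auto simp: member_def)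
  \<comment> \<open>One point lies on the member through another exactly if the converse holds. So
    keeping u off the members through the exceptional points keeps these points off g.\<close>
  have member_swap: "ev (member s t) s' t' = - ev (member s' t') s t" for s t s' t'
    by (simp add: member_def)
  have "w \<noteq> 0"
    unfolding w_def
  proof (rule wronskian_nonzero)
    fix \<alpha> \<beta>
    assume "smult \<alpha> (dehom G) + smult \<beta> (dehom H) = 0"
    then have "dehom (smult [:\<alpha>:] G + smult [:\<beta>:] H) = 0"
      by (simp only: dehom_combination)
    moreover have "binary_form k (smult [:\<alpha>:] G + smult [:\<beta>:] H)"
      using G H by (intro binary_form_add binary_form_smult)
    ultimately show "\<alpha> = 0 \<and> \<beta> = 0"
      using dehom_eq_0 indep by blast
  qed
  define T where "T = {t. poly (w * dehom b) t = 0}"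
  have "finite T"
    unfolding T_def using \<open>w \<noteq> 0\<close> dehom_eq_0[OF b(1)] b(2) by (intro poly_roots_finite) auto
  \<comment> \<open>The point (0, 1) is added so that x does not divide g, and every linear factor
    of g is seen by the dehomogenized Wronskian.\<close>
  define D :: "(real \<times> real) set" where "D = insert (0, 1) (Pair 1 ` T)"
  define bad where "bad = T \<union> (\<Union>(s, t)\<in>D. {u. poly (dehom (member s t)) u = 0})"
  have "finite {u. poly (dehom (member s t)) u = 0}" if "(s, t) \<in> D" for s t
  proof (rule poly_roots_finite)
    from that have "s \<noteq> 0 \<or> t \<noteq> 0" by (auto simp: D_def)
    then show "dehom (member s t) \<noteq> 0"
      using member_nz dehom_eq_0 member_form by metis
  qed
  moreover have "finite D"
    using \<open>finite T\<close> by (simp add: D_def)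
  ultimately have "finite bad"
    using \<open>finite T\<close> unfolding bad_def by auto
  then obtain u where u: "u \<notin> bad"
    using ex_new_if_finite infinite_UNIV_char_0 by metis
  define g where "g = member 1 u"
  have g_D: "ev g s t \<noteq> 0" if "(s, t) \<in> D" for s t
    using u that member_swap[of 1 u s t] by (auto simp: g_def bad_def)
  have "\<not> m ^ 2 dvd g \<and> \<not> m dvd b" if m: "linear_form m" "m dvd g" for m
    using m(1)
  proof (cases rule: linear_form_root_cases)
    case 1
    then have "ev g 0 1 = 0"
      using m(2) member_form unfolding g_def by blast
    then show ?thesis
      using g_D[of 0 1] by (simp add: D_def)
  next
    case (2 t)
    then have gt: "ev g 1 t = 0"
      using m(2) member_form unfolding g_def by blast
    then have t: "t \<notin> T"
      using g_D[of 1 t] by (auto simp: D_def)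
    then have "\<not> m dvd b"
      using 2[OF b(1)] by (simp add: T_def)
    moreover have "\<not> m ^ 2 dvd g"
    proof
      assume "m ^ 2 dvd g"
      then obtain h where "g = m * m * h"
        by (auto simp: power2_eq_square elim: dvdE)
      then have "dehom g = dehom m * dehom m * dehom h"
        by (simp add: dehom_mult)
      moreover have "poly (dehom m) t = 0"
        using 2[of 1 m] m(1) by (simp add: linear_form_def)
      ultimately have "poly (pderiv (dehom g)) t = 0"
        using poly_pderiv_double_root by metis
      moreover define p q where "p = dehom G" and "q = dehom H"
      moreover define x y where "x = ev H 1 u" and "y = ev G 1 u"
      moreover have "dehom g = smult x p + smult (- y) q"
        unfolding g_def member_def dehom_combination p_def q_def x_def y_def ..
      ultimately have eqs: "x * poly p t = y * poly q t" "x * poly (pderiv p) t = y * poly (pderiv q) t"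
        using gt poly_dehom[of g t] by (simp_all add: pderiv_add pderiv_diff pderiv_smult pderiv_minus)
      \<comment> \<open>A double zero of g at t gives two homogeneous linear equations for (x, y),
        which is nonzero by base point freeness. Their determinant is, up to sign, the Wronskian at
        t, and must vanish.\<close>
      define W where "W = poly p t * poly (pderiv q) t - poly (pderiv p) t * poly q t"
      have "x * W = (x * poly p t) * poly (pderiv q) t - (x * poly (pderiv p) t) * poly q t"
        by (simp add: W_def algebra_simps)
      also have "\<dots> = 0"
        unfolding eqs by simp
      finally have "x * W = 0" .
      moreover have "y * W = poly p t * (y * poly (pderiv q) t) - poly (pderiv p) t * (y * poly q t)"
        by (simp add: W_def algebra_simps)
      then have "y * W = 0"
        unfolding eqs[symmetric] by simp
      moreover have "x \<noteq> 0 \<or> y \<noteq> 0"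
        using base_point_free[of 1 u] by (auto simp: x_def y_def)
      ultimately have "W = 0"
        by auto
      then have "poly w t = 0"
        by (simp add: w_def W_def p_def q_def)
      with t show False
        by (simp add: T_def)
    qed
    ultimately show ?thesis by blast
  qed
  moreover have "lin (- u) 1 dvd g"
    unfolding g_def using lin_dvd_iff[OF member_form, of "- u" 1] by (simp add: member_def)
  moreover have "linear_form (lin (- u) 1)"
    by (rule linear_form_lin) simp
  moreover have "g \<noteq> 0"
    unfolding g_def by (rule member_nz) simp
  moreover have "g = smult [:ev H 1 u:] G + smult [:- ev G 1 u:] H"
    by (simp add: g_def member_def)
  ultimately show ?thesis by blast
qed

section \<open>Passing from the pencil to higher degrees\<close>

lemma linear_form_dvd_commute:
  assumes "linear_form l" "linear_form m" "l dvd m"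
  shows "m dvd l"
proof -
  obtain c where c: "m = smult [:c:] l"
    using linear_form_dvd_linear_form assms by blast
  then have "c \<noteq> 0"
    using assms(2) by (auto simp: linear_form_def)
  then have "l = m * [:[:1 / c:]:]"
    using c by simp
  then show ?thesis by (rule dvdI)
qed

text \<open>The new factor is simple because l does not divide g, and the old ones stay simple
  because none of them is proportional to l.\<close>

lemma almost_real_roots_mult:
  assumes g: "almost_real_roots r g" and "2 \<le> r" and l: "linear_form l" "\<not> l dvd g"
  shows "almost_real_roots (Suc r) (g * l)"
proof -
  obtain L where L: "finite L" "r - 2 \<le> card L" "\<And>m. m \<in> L \<Longrightarrow> linear_form m \<and> m dvd g \<and> \<not> m ^ 2 dvd g"
    "pairwise (\<lambda>l m. \<forall>c. m \<noteq> smult [:c:] l) L" and gr: "binary_form r g" "g \<noteq> 0"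
    using g unfolding almost_real_roots_def by blast
  have l': "binary_form 1 l" "l \<noteq> 0"
    using l by (simp_all add: linear_form_def)
  have ndvd: "\<not> l dvd m" "\<not> m dvd l" if "m \<in> L" for m
    using L(3)[OF that] l linear_form_dvd_commute dvd_trans by metis+
  have "m dvd g * l \<and> \<not> m ^ 2 dvd g * l" if m: "m \<in> L" for m
  proof -
    have lm: "linear_form m" "m dvd g" "\<not> m ^ 2 dvd g" "m \<noteq> 0"
      using L(3)[OF m] by (auto simp: linear_form_def)
    obtain s h where h: "g = m * h" "binary_form s h"
      using linear_form_dvdE[OF lm(1) gr lm(2)] by metis
    have "\<not> m ^ 2 dvd g * l"
    proof
      assume "m ^ 2 dvd g * l"
      then have "m dvd h * l"
        using \<open>m \<noteq> 0\<close> by (simp add: h power2_eq_square mult.assoc)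
      then have "m dvd h"
        using linear_form_dvd_mult[OF lm(1) h(2) l'(1)] ndvd[OF m] by blast
      with lm(3) show False
        by (simp add: h power2_eq_square)
    qed
    with lm(2) show ?thesis by simp
  qed
  moreover have "\<not> l ^ 2 dvd g * l"
    using l l' by (simp add: power2_eq_square)
  moreover have "pairwise (\<lambda>l m. \<forall>c. m \<noteq> smult [:c:] l) (insert l L)"
  proof -
    have "\<forall>c. m \<noteq> smult [:c:] l" "\<forall>c. l \<noteq> smult [:c:] m" if "m \<in> L" for m
      using ndvd[OF that] by (auto simp: dvd_smult)
    with L(4) show ?thesis
      by (simp add: pairwise_insert)
  qed
  moreover have "l \<notin> L"
    using ndvd(1)[of l] by auto
  then have "Suc r - 2 \<le> card (insert l L)"
    using L(1,2) by simp
  moreover have "binary_form (Suc r) (g * l)"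
    using binary_form_mult[OF gr(1) l'(1)] by simp
  ultimately show ?thesis
    unfolding almost_real_roots_def using L(1,3) l gr(2) l'(2)
    by (intro conjI exI[of _ "insert l L"]) auto
qed

text \<open>Lets the absence of apolar forms in a single degree r bound generator degrees from
  below: a generator of degree at most r would produce one.\<close>

lemma apolar_ideal_form_raise:
  assumes "binary_form a G" "G \<noteq> 0" "G \<in> apolar_ideal F" "a \<le> r"
  shows "\<exists>f. binary_form r f \<and> f \<noteq> 0 \<and> f \<in> apolar_ideal F"
proof (intro exI conjI)
  show "binary_form r (X ^ (r - a) * G)"
    using binary_form_mult[OF binary_form_X_power assms(1), of "r - a"] assms(4) by simp
  show "X ^ (r - a) * G \<in> apolar_ideal F"
    by (rule apolar_ideal_mult[OF assms(3)])
qed (use assms(2) in \<open>simp add: X_power\<close>)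

text \<open>A common zero of G and H would be a zero of every apolar form, in particular of x^(d+1)
  and y^(d+1).\<close>

lemma generates_base_point_free:
  assumes "binary_form d F" "generates F a G b H" "s \<noteq> 0 \<or> t \<noteq> 0"
  shows "ev G s t \<noteq> 0 \<or> ev H s t \<noteq> 0"
proof (rule ccontr)
  assume 0: "\<not> ?thesis"
  have *: "ev f s t = 0" if f: "binary_form (Suc d) f" for f
  proof -
    obtain u v where "f = u * G + v * H"
      using apolar_ideal_above_degree[OF assms(1) f] assms(2) unfolding generates_def by auto
    with 0 show ?thesis by simp
  qed
  have "binary_form (Suc d) (X ^ Suc d)" "binary_form (Suc d) (Y ^ Suc d)"
    using binary_form_power[OF binary_form_X, of "Suc d"] binary_form_power[OF binary_form_Y, of "Suc d"]
    by simp_all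
  then have "ev (X ^ Suc d) s t = 0" "ev (Y ^ Suc d) s t = 0"
    using * by blast+
  then show False
    using assms(3) unfolding ev_simps(7) by (simp add: ev_simps(3,4) del: power_Suc)
qed

text \<open>With \<open>\<beta>\<close> nonzero, H would be a constant multiple of G and G alone
  would generate the ideal.\<close>

lemma generates_independent:
  assumes "binary_form d F" "F \<noteq> 0" "generates F a G b H"
    and dep: "smult [:\<alpha>:] G + smult [:\<beta>:] H = 0"
  shows "\<beta> = 0"
proof (rule ccontr)
  assume "\<beta> \<noteq> 0"
  have "smult [:\<beta>:] H = smult (- [:\<alpha>:]) G"
    using dep unfolding smult_minus_left by (simp add: eq_neg_iff_add_eq_0 add.commute)
  then have "smult [:\<beta>:] H = smult [:- \<alpha>:] G"
    by simp
  then have "H = smult [:1 / \<beta>:] (smult [:- \<alpha>:] G)"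
    using \<open>\<beta> \<noteq> 0\<close> by (rule smult_cancel)
  then have H: "H = [:[:- \<alpha> / \<beta>:]:] * G"
    by simp
  have "\<exists>u. f = u * G" if f: "f \<in> apolar_ideal F" for f
  proof -
    obtain u v where "f = u * G + v * H"
      using f assms(3) unfolding generates_def by blast
    then have "f = (u + v * [:[:- \<alpha> / \<beta>:]:]) * G"
      unfolding H by (simp only: distrib_right mult.assoc)
    then show ?thesis by blast
  qed
  with not_generated_by_one[OF assms(1,2)] generates_mem[OF assms(3)] assms(3) show False
    unfolding generates_def by blast
qed

lemma generates_ordered:
  assumes "binary_form d F" "F \<noteq> 0"
  obtains a G b H where "generates F a G b H" "a + b = d + 2" "a \<le> b"
proof -
  obtain a G b H where "generates F a G b H" "a + b = d + 2"
    using generators_exist[OF assms] by blast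
  then show ?thesis
    using that[of a G b H] that[of b H a G] generates_commute by (metis add.commute nat_le_linear)
qed

text \<open>The form b strengthens the induction: in the step it absorbs l, so that the form found
  one degree lower is not divisible by l and multiplication by l creates no multiple factor.\<close>

lemma almost_real_apolar_form_exists:
  assumes "k = 3 \<or> k = 4" "binary_form (2 * k - 2 + n) F" "binary_form e b" "b \<noteq> 0"
    and "\<And>c. binary_form (k - 1) c \<Longrightarrow> c \<in> apolar_ideal F \<Longrightarrow> c = 0"
  shows "\<exists>g\<in>apolar_ideal F. almost_real_roots (k + n) g \<and>
    (\<forall>m. linear_form m \<longrightarrow> m dvd g \<longrightarrow> \<not> m dvd b)"
  using assms(2-)
proof (induction n arbitrary: F e b)
  case (0 F e b)
  note F = 0(1) and no_small = 0(4)
  have "F \<noteq> 0"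
    using no_small[of "X ^ (k - 1)"] binary_form_X_power by (auto simp: apolar_ideal_iff X_power)
  then obtain a G b' H where gen: "generates F a G b' H" and "a + b' = 2 * k - 2 + 0 + 2" "a \<le> b'"
    using generates_ordered[OF F] by blast
  with assms(1) have ab: "a + b' = 2 * k" "a \<le> b'"
    by auto
  have G: "binary_form a G" "G \<noteq> 0"
    using gen by (simp_all add: generates_def)
  have "a \<ge> k"
    using apolar_ideal_form_raise[OF G generates_mem(1)[OF gen], of "k - 1"] no_small assms(1)
    by fastforce
  then have "a = k" "b' = k"
    using ab by simp_all
  then have forms: "binary_form k G" "binary_form k H"
    using gen by (simp_all add: generates_def)
  have indep: "\<alpha> = 0 \<and> \<beta> = 0" if "smult [:\<alpha>:] G + smult [:\<beta>:] H = 0" for \<alpha> \<beta>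
    using generates_independent[OF F \<open>F \<noteq> 0\<close> gen, of \<alpha> \<beta>]
      generates_independent[OF F \<open>F \<noteq> 0\<close> generates_commute[OF gen], of \<beta> \<alpha>] that
    by (simp add: add.commute)
  obtain \<alpha> \<beta> g l where g: "g = smult [:\<alpha>:] G + smult [:\<beta>:] H" "g \<noteq> 0"
    and l: "linear_form l" "l dvd g"
    and simple: "\<And>m. linear_form m \<Longrightarrow> m dvd g \<Longrightarrow> \<not> m ^ 2 dvd g \<and> \<not> m dvd b"
    using pencil_member[OF forms 0(2,3) indep generates_base_point_free[OF F gen]] by metis
  have "g = [:[:\<alpha>:]:] * G + [:[:\<beta>:]:] * H"
    using g(1) by simp
  then have g_mem: "g \<in> apolar_ideal F"
    using apolar_ideal_add apolar_ideal_mult generates_mem[OF gen] by metis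
  have g_form: "binary_form k g"
    unfolding g(1) by (intro binary_form_add binary_form_smult forms)
  have "\<exists>L. finite L \<and> k - 2 \<le> card L \<and> (\<forall>l\<in>L. linear_form l \<and> l dvd g \<and> \<not> l ^ 2 dvd g) \<and>
      pairwise (\<lambda>l m. \<forall>c. m \<noteq> smult [:c:] l) L"
  proof (cases "k = 3")
    case True
    then show ?thesis
      using l simple by (intro exI[of _ "{l}"]) auto
  next
    case False
    \<comment> \<open>For k = 4 the cofactor of l is a cubic and has a real linear factor m, not
      proportional to l because l^2 does not divide g. These are the two simple factors required of
      a quartic.\<close>
    obtain s h where h: "k = Suc s" "g = l * h" "binary_form s h"
      using linear_form_dvdE[OF l(1) g_form g(2) l(2)] by metis
    then have "binary_form 3 h"
      using False assms(1) by auto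
    then obtain m where m: "linear_form m" "m dvd h"
      using cubic_form_linear_factor by blast
    have "m dvd g"
      using m(2) h(2) by simp
    have ndvd: "\<not> l dvd m" "\<not> m dvd l"
      using simple[OF l] simple[OF m(1) \<open>m dvd g\<close>] m(2) mult_dvd_mono[of _ l m h]
      unfolding h(2) power2_eq_square by (meson dvd_refl dvd_trans mult_dvd_mono)+
    then have "l \<noteq> m" "pairwise (\<lambda>l m. \<forall>c. m \<noteq> smult [:c:] l) {l, m}"
      by (auto simp: pairwise_insert dvd_smult)
    then show ?thesis
      using l m(1) \<open>m dvd g\<close> simple False assms(1) by (intro exI[of _ "{l, m}"]) auto
  qed
  then have "almost_real_roots k g"
    using g(2) g_form unfolding almost_real_roots_def by blast
  then show ?case
    using g_mem simple by auto
next
  case (Suc n F e b)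
  note F = Suc.prems(1) and no_small = Suc.prems(4)
  have "F \<noteq> 0"
    using no_small[of "X ^ (k - 1)"] binary_form_X_power by (auto simp: apolar_ideal_iff X_power)
  then obtain a G b' H where gen: "generates F a G b' H" and "a + b' = 2 * k - 2 + Suc n + 2" "a \<le> b'"
    using generates_ordered[OF F] by blast
  with assms(1) have ab: "a + b' = 2 * k + Suc n" "a \<le> b'"
    by auto
  then have "k < b'"
    by simp
  have G: "binary_form a G" "G \<noteq> 0"
    using gen by (simp_all add: generates_def)
  \<comment> \<open>Selects u such that y - u x divides neither G nor b.\<close>
  have "dehom G * dehom b \<noteq> 0"
    using dehom_eq_0 G Suc.prems(2,3) by auto
  then have "finite {u. poly (dehom G * dehom b) u = 0}"
    by (rule poly_roots_finite)
  from ex_new_if_finite[OF infinite_UNIV_char_0 this]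
  obtain u where u: "ev G 1 u \<noteq> 0" "ev b 1 u \<noteq> 0"
    by auto
  define l where "l = lin (- u) 1"
  have l: "linear_form l" "binary_form 1 l" "l \<noteq> 0" and ev_l: "ev l 1 u = 0"
    using linear_form_lin[of "- u" 1] by (simp_all add: l_def linear_form_def)
  have F1: "binary_form (2 * k - 2 + n) (apolar_action l F)"
    using apolar_action_form[OF l(2) F] by simp
  \<comment> \<open>An apolar form c of \<open>apolar_action l F\<close> of degree k - 1 makes c * l
    apolar to F in degree k < b'. As G has degree at least k, c * l is a constant times G, and the
    constant is 0 because l does not divide G.\<close>
  have small: "c = 0" if c: "binary_form (k - 1) c" "c \<in> apolar_ideal (apolar_action l F)" for c
  proof -
    have "binary_form k (c * l)"
      using binary_form_mult[OF c(1) l(2)] assms(1) by auto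
    moreover have "c * l \<in> apolar_ideal F"
      using c(2) by (simp add: mult_in_apolar_ideal_iff)
    ultimately obtain u1 v where uv: "c * l = u1 * G + v * H" "binary_form (k - a) u1"
        "k < a \<longrightarrow> u1 = 0" "k < b' \<longrightarrow> v = 0"
      using generatesD[OF gen] by metis
    have "a \<ge> k"
      using apolar_ideal_form_raise[OF G generates_mem(1)[OF gen], of "k - 1"] no_small assms(1)
      by fastforce
    then have "binary_form 0 u1"
      using uv(2) by simp
    then obtain \<gamma> where \<gamma>: "u1 = smult [:\<gamma>:] 1"
      using binary_form_0_eq by blast
    have cl: "c * l = u1 * G"
      using uv \<open>k < b'\<close> by simp
    have "ev (c * l) 1 u = \<gamma> * ev G 1 u"
      unfolding cl \<gamma> by simp
    then have "\<gamma> = 0"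
      using u(1) ev_l by simp
    then show "c = 0"
      using cl \<gamma> l(3) by simp
  qed
  have bl: "binary_form (e + 1) (b * l)" "b * l \<noteq> 0"
    using Suc.prems(2,3) l by (auto intro: binary_form_mult simp del: Suc_eq_plus1 add_Suc_right)
  obtain g where g: "g \<in> apolar_ideal (apolar_action l F)" "almost_real_roots (k + n) g"
    and coprime: "\<And>m. linear_form m \<Longrightarrow> m dvd g \<Longrightarrow> \<not> m dvd b * l"
    using Suc.IH[OF F1 bl small] by blast
  have "g * l \<in> apolar_ideal F"
    using g(1) by (simp add: mult_in_apolar_ideal_iff)
  moreover have "\<not> l dvd g"
    using coprime[OF l(1)] by auto
  then have "almost_real_roots (k + Suc n) (g * l)"
    using almost_real_roots_mult[OF g(2) _ l(1)] assms(1) by auto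
  moreover have "\<not> m dvd b" if m: "linear_form m" "m dvd g * l" for m
  proof -
    have "binary_form (k + n) g"
      using g(2) by (simp add: almost_real_roots_def)
    then consider "m dvd g" | "m dvd l"
      using linear_form_dvd_mult[OF m(1) _ l(2) m(2)] by blast
    then show ?thesis
    proof cases
      case 2
      then have "l dvd m"
        using linear_form_dvd_commute m(1) l(1) by blast
      moreover have "\<not> l dvd b"
        using u(2) lin_dvd_iff[OF Suc.prems(2), of "- u" 1] by (simp add: l_def)
      ultimately show ?thesis
        using dvd_trans by blast
    qed (use coprime[OF m(1)] in auto)
  qed
  ultimately show ?case by blast
qed

section \<open>The equivalences for almost real rank d - 1\<close>

theorem theorem7p5:
  fixes d :: nat and F :: "real poly poly"
  assumes "d \<ge> 5" and "binary_form d F" and "F \<noteq> 0"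
  shows "(\<exists>F_perp F_circ. apolar_generators d F F_perp F_circ) \<and>
    (\<forall>F_perp F_circ. apolar_generators d F F_perp F_circ \<longrightarrow>
      (ar_rk F = d - 1 \<longleftrightarrow> (\<exists>l. linear_form l \<and> F_perp = l ^ 3)) \<and>
      ((\<exists>l. linear_form l \<and> F_perp = l ^ 3) \<longleftrightarrow>
        (\<exists>l. linear_form l \<and> l ^ 3 \<in> apolar_ideal F) \<and>
        \<not> (\<exists>q. q \<noteq> 0 \<and> binary_form 2 q \<and> q \<in> apolar_ideal F)))"
proof (intro conjI allI impI)
  obtain a G b H where "generates F a G b H" "a + b = d + 2" "a \<le> b"
    using generates_ordered[OF assms(2,3)] .
  then show "\<exists>F_perp F_circ. apolar_generators d F F_perp F_circ"
    unfolding generates_def apolar_generators_def by blast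
next
  fix G H
  assume "apolar_generators d F G H"
  then obtain a b where gen: "generates F a G b H" and ab: "a + b = d + 2" "a \<le> b"
    unfolding generates_def apolar_generators_def by blast
  then have G: "binary_form a G" "G \<noteq> 0"
    by (simp_all add: generates_def)
  note G_mem = generates_mem(1)[OF gen]
  have cube_form: "binary_form 3 (l ^ 3)" "l ^ 3 \<noteq> 0" if "linear_form l" for l
    using binary_form_power[of 1 l 3] that by (simp_all add: linear_form_def)
  \<comment> \<open>In degrees below b the second generator cannot contribute, so apolar forms are
    multiples of G.\<close>
  have low: "\<exists>u. f = u * G \<and> binary_form (r - a) u \<and> (r < a \<longrightarrow> u = 0)"
    if f: "binary_form r f" "f \<in> apolar_ideal F" "r < b" for r f
  proof -
    obtain u v where "f = u * G + v * H" "binary_form (r - a) u" "r < a \<longrightarrow> u = 0" "r < b \<longrightarrow> v = 0"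
      using generatesD[OF gen f(1,2)] by metis
    with f(3) show ?thesis by auto
  qed
  have cubeD: "a = 3 \<and> b = d - 1" if "linear_form l" "G = l ^ 3" for l
    using binary_form_unique_degree[OF G(1) _ G(2)] cube_form[OF that(1)] that(2) ab by force
  have no_quadric: "q = 0" if "linear_form l" "G = l ^ 3" "binary_form 2 q" "q \<in> apolar_ideal F" for l q
    using low[OF that(3,4)] cubeD[OF that(1,2)] assms(1) by auto
  show "(\<exists>l. linear_form l \<and> G = l ^ 3) \<longleftrightarrow>
      (\<exists>l. linear_form l \<and> l ^ 3 \<in> apolar_ideal F) \<and>
      \<not> (\<exists>q. q \<noteq> 0 \<and> binary_form 2 q \<and> q \<in> apolar_ideal F)"
  proof
    assume "\<exists>l. linear_form l \<and> G = l ^ 3"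
    then show "(\<exists>l. linear_form l \<and> l ^ 3 \<in> apolar_ideal F) \<and>
      \<not> (\<exists>q. q \<noteq> 0 \<and> binary_form 2 q \<and> q \<in> apolar_ideal F)"
      using G_mem no_quadric by blast
  next
    assume "(\<exists>l. linear_form l \<and> l ^ 3 \<in> apolar_ideal F) \<and>
      \<not> (\<exists>q. q \<noteq> 0 \<and> binary_form 2 q \<and> q \<in> apolar_ideal F)"
    then obtain l where l: "linear_form l" "l ^ 3 \<in> apolar_ideal F"
      and no_quadric: "\<And>q. binary_form 2 q \<Longrightarrow> q \<in> apolar_ideal F \<Longrightarrow> q = 0"
      by blast
    have "a \<ge> 3"
      using apolar_ideal_form_raise[OF G G_mem, of 2] no_quadric by force
    \<comment> \<open>Here a + b = d + 2 is at least 7 and a is at most b. Hence the cube lies below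
      degree b, and since a is at least 3 it is a constant times G.\<close>
    have "3 < b"
      using ab assms(1) by simp
    from low[OF cube_form(1)[OF l(1)] l(2) this] \<open>a \<ge> 3\<close>
    obtain u where u: "l ^ 3 = u * G" "binary_form 0 u"
      by auto
    then obtain c where c: "u = smult [:c:] 1"
      using binary_form_0_eq by blast
    then have "smult [:c:] G = l ^ 3"
      using u(1) by simp
    moreover from this have "c \<noteq> 0"
      using cube_form(2)[OF l(1)] by auto
    ultimately have "G = smult [:1 / c:] (l ^ 3)"
      by (rule smult_cancel)
    then show "\<exists>l. linear_form l \<and> G = l ^ 3"
      using smult_cube_is_cube[OF l(1), of "1 / c"] \<open>c \<noteq> 0\<close> by auto
  qed
  have ar_rk_le: "ar_rk F \<le> r" if "g \<in> apolar_ideal F" "almost_real_roots r g" for r g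
    unfolding ar_rk_def using that by (blast intro: Least_le)
  show "ar_rk F = d - 1 \<longleftrightarrow> (\<exists>l. linear_form l \<and> G = l ^ 3)"
  proof
    assume "\<exists>l. linear_form l \<and> G = l ^ 3"
    then obtain l where l: "linear_form l" "G = l ^ 3" by blast
    from cubeD[OF this] have [simp]: "a = 3" and b: "b = d - 1" by simp_all
    show "ar_rk F = d - 1"
      unfolding ar_rk_def
    proof (rule Least_equality)
      \<comment> \<open>With k = 3 and n = d - 4 the degree 2 k - 2 + n is d. The constant form 1 of
        degree 0 expresses that no factor has to be avoided.\<close>
      have "\<exists>g\<in>apolar_ideal F. almost_real_roots (3 + (d - 4)) g \<and>
          (\<forall>m. linear_form m \<longrightarrow> m dvd g \<longrightarrow> \<not> m dvd 1)"
        using almost_real_apolar_form_exists[of 3 "d - 4" F 0 1] no_quadric[OF l] assms(1,2) by simp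
      moreover have "3 + (d - 4) = d - 1"
        using assms(1) by simp
      ultimately show "\<exists>g\<in>apolar_ideal F. almost_real_roots (d - 1) g"
        by auto
    next
      fix r
      assume "\<exists>g\<in>apolar_ideal F. almost_real_roots r g"
      then obtain g L where g: "g \<in> apolar_ideal F" "g \<noteq> 0" "binary_form r g"
        and L: "finite L" "r - 2 \<le> card L" "\<And>m. m \<in> L \<Longrightarrow> linear_form m \<and> m dvd g \<and> \<not> m ^ 2 dvd g"
          "pairwise (\<lambda>l m. \<forall>c. m \<noteq> smult [:c:] l) L"
        unfolding almost_real_roots_def by blast
      show "d - 1 \<le> r"
      proof (rule ccontr)
        assume "\<not> d - 1 \<le> r"
        then obtain u where u: "g = u * G" "binary_form (r - 3) u" "r < 3 \<longrightarrow> u = 0"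
          using low[OF g(3,1)] b by auto
        then have "r \<ge> 3" "u \<noteq> 0"
          using g(2) by auto
        \<comment> \<open>A simple factor of g = u * l^3 cannot divide l, since its square would
          then divide l^3. So all of the at least r - 2 simple factors divide u, which has degree
          only r - 3.\<close>
        have "linear_form m \<and> m dvd u" if m: "m \<in> L" for m
        proof -
          have lm: "linear_form m" "m dvd u * l ^ 3" "\<not> m ^ 2 dvd u * l ^ 3"
            using L(3)[OF m] u(1) l(2) by auto
          have "\<not> m dvd l"
            using lm(3) dvd_mult[OF dvd_power_le[of m l 2 3], of u] by auto
          then have "\<not> m dvd l ^ 3"
            using linear_form_dvd_mult[OF lm(1), of 1 l] linear_form_dvd_mult[OF lm(1), of 1 l 2 "l ^ 2"]
              l(1) binary_form_power[of 1 l 2]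
            by (auto simp: linear_form_def power3_eq_cube power2_eq_square mult.assoc)
          then show ?thesis
            using linear_form_dvd_mult[OF lm(1) u(2) cube_form(1)[OF l(1)] lm(2)] lm(1) by blast
        qed
        from card_linear_factors_le[OF L(1) u(2) \<open>u \<noteq> 0\<close> this L(4)] L(2) \<open>r \<ge> 3\<close> show False
          by simp
      qed
    qed
  next
    assume rk: "ar_rk F = d - 1"
    show "\<exists>l. linear_form l \<and> G = l ^ 3"
    proof (rule ccontr)
      assume not_cube: "\<not> ?thesis"
      have "\<exists>r g. r < d - 1 \<and> g \<in> apolar_ideal F \<and> almost_real_roots r g"
      proof -
        consider "a \<le> 2" | "a = 3" | "a \<ge> 4" by linarith
        then show ?thesis
        proof cases
          case 1
          then have "almost_real_roots a G"
            using G unfolding almost_real_roots_def by (auto intro!: exI[of _ "{}"])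
          then show ?thesis
            using G_mem 1 assms(1) by (intro exI[of _ a] exI[of _ G]) simp
        next
          case 2
          then obtain l where "linear_form l \<and> l dvd G \<and> \<not> l ^ 2 dvd G"
            using cubic_form_simple_factor[of G] G not_cube by blast
          then have "almost_real_roots 3 G"
            using G 2 unfolding almost_real_roots_def by (auto intro!: exI[of _ "{l}"])
          then show ?thesis
            using G_mem assms(1) by (intro exI[of _ 3] exI[of _ G]) simp
        next
          case 3
          \<comment> \<open>From 4 <= a <= b it follows that d is at least 6, so k = 4 and n = d - 6
            give a form of degree d - 2.\<close>
          have "c = 0" if "binary_form 3 c" "c \<in> apolar_ideal F" for c
            using low[OF that] 3 ab by auto
          then obtain g where "g \<in> apolar_ideal F" "almost_real_roots (4 + (d - 6)) g"
            using almost_real_apolar_form_exists[of 4 "d - 6" F 0 1] 3 ab assms(2) by auto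
          then show ?thesis
            using 3 ab by (intro exI[of _ "4 + (d - 6)"] exI[of _ g]) simp
        qed
      qed
      with ar_rk_le rk show False
        by fastforce
    qed
  qed
qed

end
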